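(* Let $m\in\mathbb{N}$, let $f(z)=\sum_{n=0}^{\infty}a_nz^n\in\mathcal{B}$, $a:=|a_0|$, and let $\omega\in\mathcal{B}_m$. Then $$E_f(z):=|f(\omega(z))|+|\omega(z)|\,|f'(\omega(z))|+B_2(f,r)+\frac{1+ar}{(1+a)(1-r)}\|f_0\|_r^2\le 1$$ for all $z$ with $|z|=r\in[0,\gamma_m]$, where $\gamma_m$ is the unique root in $(0,1)$ of the equation $$r^m(r^m+2)(2r^2-r+1)+2r^2+r-1=0.$$ The upper bound $\gamma_m$ cannot be improved. Moreover, $$F_f(z):=|f(\omega(z))|^2+|\omega(z)|\,|f'(\omega(z))|+B_2(f,r)+\frac{1+ar}{(1+a)(1-r)}\|f_0\|_r^2\le 1$$ for all $z$ with $|z|=r\in[0,\delta_m]$, where $\delta_m$ is the unique root in $(0,1)$ of the equation $$(r^{2m}+r^m-1)(1-r)+r^2(1+r^m)^2=0.$$ The upper bound $\delta_m$ cannot be improved.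
   Context: $\mathbb{D}=\{z\in\mathbb{C}:|z|<1\}$ and $\mathbb{N}=\{1,2,\dots\}$. $\mathcal{B}$ is the class of analytic functions $f$ on $\mathbb{D}$ with $\sup_{z\in\mathbb{D}}|f(z)|\le 1$. For $m\in\mathbb{N}$, $\mathcal{B}_m$ is the set of $\omega\in\mathcal{B}$ with $\omega(0)=\omega'(0)=\cdots=\omega^{(m-1)}(0)=0$ and $\omega^{(m)}(0)\ne 0$. For $f(z)=\sum_{n\ge 0}a_nz^n\in\mathcal{B}$ put $f_0(z)=f(z)-f(0)$, $B_k(f,r)=\sum_{n=k}^{\infty}|a_n|r^n$ for $k\ge 0$, and $\|f_0\|_r^2=\sum_{n=1}^{\infty}|a_n|^2r^{2n}$. $f'(\omega(z))$ is the derivative of $f$ evaluated at the point $\omega(z)$. Throughout $r=|z|<1$. Saying that a constant $\rho$ (for given $m$) cannot be improved means that there is no $\rho'\in(\rho,1)$ such that the corresponding inequality holds for all $f\in\mathcal{B}$, all $\omega\in\mathcal{B}_m$ and all $z$ with $|z|\le\rho'$. *)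

theory Defs
  imports "HOL-Complex_Analysis.Complex_Analysis"
begin

definition class_B :: "(complex \<Rightarrow> complex) set" where
  "class_B = {f. f analytic_on ball 0 1 \<and> (\<forall>z\<in>ball 0 1. norm (f z) \<le> 1)}"

definition class_Bm :: "nat \<Rightarrow> (complex \<Rightarrow> complex) set" where
  "class_Bm m = {\<omega> \<in> class_B. (\<forall>k<m. (deriv ^^ k) \<omega> 0 = 0) \<and> (deriv ^^ m) \<omega> 0 \<noteq> 0}"

definition taylor_coeff :: "(complex \<Rightarrow> complex) \<Rightarrow> nat \<Rightarrow> complex" where
  "taylor_coeff f n = (deriv ^^ n) f 0 / fact n"

definition majorant_tail :: "nat \<Rightarrow> (complex \<Rightarrow> complex) \<Rightarrow> real \<Rightarrow> real" where
  "majorant_tail k f r = (\<Sum>n. norm (taylor_coeff f (n + k)) * r ^ (n + k))"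

text \<open>This is \<open>\<parallel>f\<^sub>0\<parallel>\<^sub>r\<^sup>2\<close>, where \<open>f\<^sub>0 z = f z - f 0\<close>; hence the sum starts at index 1.\<close>
definition f0_norm_sq :: "(complex \<Rightarrow> complex) \<Rightarrow> real \<Rightarrow> real" where
  "f0_norm_sq f r = (\<Sum>n. norm (taylor_coeff f (n + 1)) ^ 2 * r ^ (2 * (n + 1)))"

definition bohr_rest :: "(complex \<Rightarrow> complex) \<Rightarrow> real \<Rightarrow> real" where
  "bohr_rest f r =
     (let a = norm (taylor_coeff f 0)
      in majorant_tail 2 f r + (1 + a * r) / ((1 + a) * (1 - r)) * f0_norm_sq f r)"

definition bohr_E :: "(complex \<Rightarrow> complex) \<Rightarrow> (complex \<Rightarrow> complex) \<Rightarrow> complex \<Rightarrow> real" where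
  "bohr_E f \<omega> z =
     norm (f (\<omega> z)) + norm (\<omega> z) * norm (deriv f (\<omega> z)) + bohr_rest f (norm z)"

definition bohr_F :: "(complex \<Rightarrow> complex) \<Rightarrow> (complex \<Rightarrow> complex) \<Rightarrow> complex \<Rightarrow> real" where
  "bohr_F f \<omega> z =
     norm (f (\<omega> z)) ^ 2 + norm (\<omega> z) * norm (deriv f (\<omega> z)) + bohr_rest f (norm z)"

text \<open>The coefficients above are those of the power series of \<open>f\<close>, and for
  \<open>0 \<le> r < 1\<close> the series in the definitions converge, so that the infinite sums
  have their intended values.\<close>

lemma taylor_coeff_sums:
  assumes "f \<in> class_B" "norm z < 1"
  shows "(\<lambda>n. taylor_coeff f n * z ^ n) sums f z"
proof -
  have "f holomorphic_on ball 0 1"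
    using assms(1) by (auto simp: class_B_def analytic_imp_holomorphic)
  from holomorphic_power_series[OF this, of z] assms(2) show ?thesis
    by (simp add: taylor_coeff_def)
qed

lemma summable_taylor_coeff:
  assumes "f \<in> class_B" "0 \<le> r" "r < 1"
  shows "summable (\<lambda>n. norm (taylor_coeff f n) * r ^ n)"
proof -
  obtain s where s: "r < s" "s < 1" using assms(3) dense by blast
  have "summable (\<lambda>n. taylor_coeff f n * of_real s ^ n)"
    using taylor_coeff_sums[OF assms(1), of "of_real s"] s assms(2)
    by (auto simp: sums_iff)
  from powser_insidea[OF this, of "of_real r"] s assms(2) show ?thesis
    by (simp add: norm_mult norm_power)
qed

lemma summable_majorant_tail:
  assumes "f \<in> class_B" "0 \<le> r" "r < 1"
  shows "summable (\<lambda>n. norm (taylor_coeff f (n + k)) * r ^ (n + k))"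
  using summable_ignore_initial_segment[OF summable_taylor_coeff[OF assms]] .

lemma summable_f0_norm_sq:
  assumes "f \<in> class_B" "0 \<le> r" "r < 1"
  shows "summable (\<lambda>n. norm (taylor_coeff f (n + 1)) ^ 2 * r ^ (2 * (n + 1)))"
proof -
  let ?c = "\<lambda>n. norm (taylor_coeff f n) * r ^ n"
  have s: "summable ?c" by (rule summable_taylor_coeff[OF assms])
  have "eventually (\<lambda>n. ?c n < 1) sequentially"
    using order_tendstoD(2)[OF summable_LIMSEQ_zero[OF s], of 1] by simp
  then have "eventually (\<lambda>n. norm (?c n ^ 2) \<le> ?c n) sequentially"
    by eventually_elim
       (use assms(2) in \<open>simp add: power2_eq_square mult_left_le_one_le abs_mult\<close>)
  from summable_comparison_test_ev[OF this s]
  have "summable (\<lambda>n. ?c n ^ 2)" .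
  from summable_ignore_initial_segment[OF this, of 1] show ?thesis
    by (simp only: power_mult_distrib power_mult[symmetric] mult.commute[of 2])
qed

end

theory Submission
  imports Defs
begin

text \<open>
  Write \<open>a = \<bar>f(0)\<bar>\<close>, \<open>c\<^sub>n\<close> for the Taylor coefficients of \<open>f\<close>, and \<open>s = \<bar>\<omega>(z)\<bar>\<close>. The Schwarz
  lemma for a zero of order \<open>m\<close> gives \<open>s \<le> r^m\<close> (\<open>order_m_Schwarz\<close>). Everything then rests on
  two estimates that are attained simultaneously.

  The first one is \<open>bohr_rest f r \<le> (1 - a\<^sup>2) r\<^sup>2 / (1 - r)\<close> (\<open>bohr_rest_le\<close>). It comes from
  Carlson's coefficient inequalities (\<open>carlson_inequality\<close>): \<open>\<bar>c\<^sub>N\<bar>\<close> is at most \<open>1\<close> minus the sum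
  of \<open>\<bar>c\<^sub>k\<bar>\<^sup>2\<close> over \<open>2k < N\<close>, minus \<open>\<bar>c\<^sub>k\<bar>\<^sup>2 / (1 + a)\<close> if \<open>2k = N\<close>. When this is multiplied
  by \<open>r^N\<close> and summed over \<open>N \<ge> 2\<close>, each \<open>\<bar>c\<^sub>k\<bar>\<^sup>2\<close> with \<open>k \<ge> 1\<close> collects the factor
  \<open>r^(2k) / (1 + a) + r^(2k+1) / (1 - r)\<close>, which is \<open>r^(2k)\<close> times the factor in front of
  \<open>\<parallel>f\<^sub>0\<parallel>\<^sub>r\<^sup>2\<close>. Carlson's inequalities in turn express that the lower triangular Toeplitz matrices
  of the Taylor coefficients are contractions (\<open>toeplitz_bound\<close>), tested on vectors built from
  the coefficients themselves.

  The second one is the Schwarz-Pick lemma in its two forms (\<open>Schwarz_Pick_norm_le\<close>,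
  \<open>Schwarz_Pick_deriv\<close>), which bounds \<open>\<bar>f(\<omega>(z))\<bar>\<^sup>p + \<bar>\<omega>(z)\<bar> \<bar>f'(\<omega>(z))\<bar>\<close> for \<open>p = 1, 2\<close> by a
  function of \<open>a\<close> and \<open>s\<close>. The inequalities that remain, once a common factor \<open>1 - a\<close> or
  \<open>1 - a\<^sup>2\<close> is removed, are worst for \<open>s = r^m\<close> and \<open>a \<rightarrow> 1\<close>. In this limit they say that the
  polynomials in the statement are nonpositive. Divided by \<open>1 - r\<close>, these polynomials are strictly
  increasing on \<open>[0, 1)\<close>, whence the unique roots \<open>\<gamma>\<close> and \<open>\<delta>\<close> (\<open>unique_sign_change\<close>).

  For \<open>f(z) = (z + a) / (1 + a z)\<close>, \<open>\<omega>(z) = z^m\<close> and \<open>z = r > 0\<close> the Schwarz lemma and both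
  estimates hold with equality, so beyond the roots the inequalities fail once \<open>a < 1\<close> is close
  to \<open>1\<close> (\<open>bohr_E_sharp\<close>, \<open>bohr_F_sharp\<close>).
\<close>

section \<open>Toeplitz contractions from circle means\<close>

lemma taylor_coeff_0 [simp]: "taylor_coeff f 0 = f 0"
  by (simp add: taylor_coeff_def)

lemma class_B_holomorphic: "f \<in> class_B \<Longrightarrow> f holomorphic_on ball 0 1"
  by (auto simp: class_B_def analytic_imp_holomorphic)

lemma class_B_norm_le: "f \<in> class_B \<Longrightarrow> norm z < 1 \<Longrightarrow> norm (f z) \<le> 1"
  by (auto simp: class_B_def)

lemma class_B_norm_at_0_le_1: "f \<in> class_B \<Longrightarrow> norm (f 0) \<le> 1"
  by (rule class_B_norm_le) auto

lemma class_BI: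
  "f holomorphic_on ball 0 1 \<Longrightarrow> (\<And>z. norm z < 1 \<Longrightarrow> norm (f z) \<le> 1) \<Longrightarrow> f \<in> class_B"
  by (auto simp: class_B_def analytic_on_open)

lemma has_integral_circle_coeff:
  assumes f: "f holomorphic_on ball 0 R" and R: "R > 1"
  shows "((\<lambda>t. f (cis t) / cis t ^ k) has_integral 2 * pi * taylor_coeff f k) {0..2*pi}"
proof -
  have "((\<lambda>u. f u / (u - 0) ^ Suc k) has_contour_integral
          (2 * pi * \<i>) / fact k * (deriv ^^ k) f 0) (circlepath 0 1)"
  proof (rule Cauchy_has_contour_integral_higher_derivative_circlepath)
    show "continuous_on (cball 0 1) f"
      by (rule holomorphic_on_imp_continuous_on[OF holomorphic_on_subset[OF f]])
         (use R in auto)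
    show "f holomorphic_on ball 0 1"
      by (rule holomorphic_on_subset[OF f]) (use R in auto)
  qed auto
  then have "((\<lambda>t. f (cis t) / cis t ^ Suc k * \<i> * cis t) has_integral
          (2 * pi * \<i>) / fact k * (deriv ^^ k) f 0) {0..2*pi}"
    unfolding circlepath_def by (subst (asm) has_contour_integral_part_circlepath_iff) auto
  then have "((\<lambda>t. (f (cis t) / cis t ^ Suc k * \<i> * cis t) * (- \<i>)) has_integral
          (2 * pi * \<i>) / fact k * (deriv ^^ k) f 0 * (- \<i>)) {0..2*pi}"
    by (rule has_integral_mult_left)
  then show ?thesis
    by (simp add: taylor_coeff_def field_simps)
qed

lemma cis_power_mult_cnj: "cis t ^ k * cnj (cis t) ^ k = 1"
  by (simp add: cis_cnj cis_mult flip: power_mult_distrib)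

lemma has_integral_circle_monomials:
  assumes f: "f holomorphic_on ball 0 R" and R: "R > 1"
  shows "((\<lambda>t. f (cis t) * cis t ^ j * cnj (cis t ^ l)) has_integral
            2 * pi * (if j \<le> l then taylor_coeff f (l - j) else 0)) {0..2*pi}"
proof (cases "j \<le> l")
  case True
  have "cis t ^ j * cnj (cis t ^ l) = 1 / cis t ^ (l - j)" for t
    using True by (simp add: power_diff cis_power_mult_cnj mult.commute divide_simps)
  then show ?thesis
    using has_integral_circle_coeff[OF f R, of "l - j"] True by (simp add: mult.assoc)
next
  case False
  have "(\<lambda>z. f z * z ^ (j - l)) holomorphic_on ball 0 R"
    by (intro holomorphic_intros f)
  from has_integral_circle_coeff[OF this R, of 0]
  have "((\<lambda>t. f (cis t) * cis t ^ (j - l)) has_integral 0) {0..2*pi}"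
    using False by (simp add: power_0_left)
  moreover have "cis t ^ j * cnj (cis t ^ l) = cis t ^ (j - l)" for t
    using cis_power_mult_cnj[of t l] power_add[of "cis t" "j - l" l] False by (simp add: mult.assoc)
  ultimately show ?thesis
    using False by (simp add: mult.assoc)
qed

lemma has_integral_circle_polynomials:
  fixes x y :: "nat \<Rightarrow> complex"
  assumes f: "f holomorphic_on ball 0 R" and R: "R > 1"
  shows "((\<lambda>t. f (cis t) * (\<Sum>j\<le>N. x j * cis t ^ j) * cnj (\<Sum>l\<le>N. y l * cis t ^ l))
            has_integral 2 * pi * (\<Sum>l\<le>N. \<Sum>j\<le>l. taylor_coeff f (l - j) * x j * cnj (y l)))
          {0..2*pi}"
proof -
  have "((\<lambda>t. \<Sum>l\<le>N. \<Sum>j\<le>N. (x j * cnj (y l)) * (f (cis t) * cis t ^ j * cnj (cis t ^ l)))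
     has_integral (\<Sum>l\<le>N. \<Sum>j\<le>N. (x j * cnj (y l)) *
        (2 * pi * (if j \<le> l then taylor_coeff f (l - j) else 0)))) {0..2*pi}"
    by (intro has_integral_sum has_integral_mult_right has_integral_circle_monomials[OF f R]) auto
  moreover have "(\<Sum>l\<le>N. \<Sum>j\<le>N. (x j * cnj (y l)) * (f (cis t) * cis t ^ j * cnj (cis t ^ l)))
      = f (cis t) * (\<Sum>j\<le>N. x j * cis t ^ j) * cnj (\<Sum>l\<le>N. y l * cis t ^ l)" for t
    by (subst sum.swap) (simp add: sum_distrib_left sum_distrib_right mult_ac)
  moreover have "(\<Sum>j\<le>N. (x j * cnj (y l)) *
        (2 * pi * (if j \<le> l then taylor_coeff f (l - j) else 0)))
      = (\<Sum>j\<le>l. 2 * pi * (taylor_coeff f (l - j) * x j * cnj (y l)))" if "l \<le> N" for l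
    by (rule sum.mono_neutral_cong_right) (use that in auto)
  ultimately show ?thesis
    by (simp add: sum_distrib_left)
qed

lemma taylor_coeff_const: "taylor_coeff (\<lambda>z. c) n = (if n = 0 then c else 0)"
  by (cases n) (auto simp: taylor_coeff_def)

lemma has_integral_circle_norm_sq:
  fixes x :: "nat \<Rightarrow> complex"
  shows "((\<lambda>t. norm (\<Sum>j\<le>N. x j * cis t ^ j) ^ 2) has_integral
            2 * pi * (\<Sum>j\<le>N. norm (x j) ^ 2)) {0..2*pi}"
proof -
  have "(\<Sum>j\<le>l. taylor_coeff (\<lambda>z. 1) (l - j) * x j * cnj (x l)) = of_real (norm (x l) ^ 2)" for l
  proof -
    have "(\<Sum>j\<le>l. taylor_coeff (\<lambda>z. 1) (l - j) * x j * cnj (x l))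
        = (\<Sum>j\<in>{l}. taylor_coeff (\<lambda>z. 1) (l - j) * x j * cnj (x l))"
      by (rule sum.mono_neutral_right) (auto simp: taylor_coeff_const)
    then show ?thesis by (simp add: complex_norm_square taylor_coeff_const del: of_real_power)
  qed
  then have "((\<lambda>t. (\<Sum>j\<le>N. x j * cis t ^ j) * cnj (\<Sum>j\<le>N. x j * cis t ^ j))
          has_integral of_real (2 * pi * (\<Sum>j\<le>N. norm (x j) ^ 2))) {0..2*pi}"
    using has_integral_circle_polynomials[where f = "\<lambda>z. 1" and R = 2 and N = N and x = x and y = x]
    by simp
  from has_integral_linear[OF this bounded_linear_Re] show ?thesis
    unfolding complex_norm_square[symmetric] o_def Re_complex_of_real .
qed

text \<open>
  The sum on the left is the mean of \<open>f X (cnj Y)\<close> over the unit circle, where \<open>X\<close> and \<open>Y\<close> are the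
  polynomials with coefficients \<open>x\<close> and \<open>y\<close>. As \<open>\<bar>f\<bar> \<le> 1\<close> on the circle, it is controlled by the
  means of \<open>\<bar>X\<bar>\<^sup>2\<close> and \<open>\<bar>Y\<bar>\<^sup>2\<close>.
\<close>
lemma toeplitz_bound_closed_disc:
  fixes x y :: "nat \<Rightarrow> complex"
  assumes f: "f holomorphic_on ball 0 R" and R: "R > 1"
    and le: "\<And>z. norm z = 1 \<Longrightarrow> norm (f z) \<le> 1"
  shows "Re (\<Sum>l\<le>N. \<Sum>j\<le>l. taylor_coeff f (l - j) * x j * cnj (y l))
           \<le> ((\<Sum>j\<le>N. norm (x j) ^ 2) + (\<Sum>l\<le>N. norm (y l) ^ 2)) / 2" (is "Re ?T \<le> ?S")
proof -
  define X where "X t = (\<Sum>j\<le>N. x j * cis t ^ j)" for t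
  define Y where "Y t = (\<Sum>j\<le>N. y j * cis t ^ j)" for t
  have "((\<lambda>t. f (cis t) * X t * cnj (Y t)) has_integral 2 * pi * ?T) {0..2*pi}"
    unfolding X_def Y_def by (rule has_integral_circle_polynomials[OF f R])
  from has_integral_linear[OF this bounded_linear_Re]
  have 1: "((\<lambda>t. Re (f (cis t) * X t * cnj (Y t))) has_integral 2 * pi * Re ?T) {0..2*pi}"
    by (simp add: o_def)
  have 2: "((\<lambda>t. (norm (X t) ^ 2 + norm (Y t) ^ 2) / 2) has_integral
      (2 * pi * (\<Sum>j\<le>N. norm (x j) ^ 2) + 2 * pi * (\<Sum>l\<le>N. norm (y l) ^ 2)) / 2) {0..2*pi}"
    unfolding X_def Y_def
    by (intro has_integral_divide has_integral_add has_integral_circle_norm_sq)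
  have "Re (f (cis t) * X t * cnj (Y t)) \<le> (norm (X t) ^ 2 + norm (Y t) ^ 2) / 2" for t
  proof -
    have "Re (f (cis t) * X t * cnj (Y t)) \<le> norm (f (cis t)) * (norm (X t) * norm (Y t))"
      using complex_Re_le_cmod[of "f (cis t) * X t * cnj (Y t)"] by (simp add: norm_mult mult_ac)
    also have "\<dots> \<le> norm (X t) * norm (Y t)"
      using le[of "cis t"] by (intro mult_left_le_one_le) auto
    also have "\<dots> \<le> (norm (X t) ^ 2 + norm (Y t) ^ 2) / 2"
      using sum_squares_bound[of "norm (X t)" "norm (Y t)"] by simp
    finally show ?thesis .
  qed
  from has_integral_le[OF 1 2 this] have "2 * pi * Re ?T \<le> 2 * pi * ?S"
    by (simp add: field_simps)
  then show ?thesis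
    by simp
qed

text \<open>
  The bilinear form of the lower triangular Toeplitz matrix of the Taylor coefficients of
  \<open>f\<close>. The functions \<open>f(\<rho> z)\<close>, \<open>\<rho> < 1\<close>, are holomorphic beyond the closed disc, and the bound
  survives \<open>\<rho> \<rightarrow> 1\<close> because only finitely many coefficients occur.
\<close>
lemma toeplitz_bound:
  fixes x y :: "nat \<Rightarrow> complex"
  assumes f: "f \<in> class_B"
  shows "Re (\<Sum>l\<le>N. \<Sum>j\<le>l. taylor_coeff f (l - j) * x j * cnj (y l))
           \<le> ((\<Sum>j\<le>N. norm (x j) ^ 2) + (\<Sum>l\<le>N. norm (y l) ^ 2)) / 2" (is "_ \<le> ?S")
proof -
  let ?T = "\<lambda>\<rho>::real. Re (\<Sum>l\<le>N. \<Sum>j\<le>l.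
              of_real \<rho> ^ (l - j) * taylor_coeff f (l - j) * x j * cnj (y l))"
  have "?T \<rho> \<le> ?S" if "0 < \<rho>" "\<rho> < 1" for \<rho>
  proof -
    let ?g = "\<lambda>z. f (of_real \<rho> * z)"
    have in_ball: "of_real \<rho> * z \<in> ball 0 1" if "norm z < 1 / \<rho>" for z :: complex
      using that \<open>0 < \<rho>\<close> by (simp add: norm_mult field_simps)
    have "taylor_coeff ?g k = of_real \<rho> ^ k * taylor_coeff f k" for k
      using higher_deriv_compose_linear[OF class_B_holomorphic[OF f], of "ball 0 (1 / \<rho>)" 0
          "of_real \<rho>" k]
        in_ball \<open>0 < \<rho>\<close>
      by (simp add: taylor_coeff_def)
    moreover have "?g holomorphic_on ball 0 (1 / \<rho>)"
      using in_ball
      by (intro holomorphic_on_compose_gen[OF _ class_B_holomorphic[OF f], unfolded o_def]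
            holomorphic_intros) auto
    moreover have "norm (?g z) \<le> 1" if "norm z = 1" for z
      using that \<open>0 < \<rho>\<close> \<open>\<rho> < 1\<close> by (intro class_B_norm_le[OF f]) (simp add: norm_mult)
    ultimately show ?thesis
      using toeplitz_bound_closed_disc[where f = ?g and R = "1 / \<rho>" and N = N and x = x and y = y]
        \<open>0 < \<rho>\<close> \<open>\<rho> < 1\<close>
      by simp
  qed
  then have "eventually (\<lambda>\<rho>. ?T \<rho> \<le> ?S) (at_left 1)"
    by (intro eventually_at_leftI[of 0]) auto
  moreover have "(?T \<longlongrightarrow> ?T 1) (at_left 1)"
    by (intro tendsto_intros)
  ultimately have "?T 1 \<le> ?S"
    by (intro tendsto_upperbound[of ?T _ "at_left 1"]) auto
  then show ?thesis by simp
qed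

section \<open>Carlson's coefficient inequalities\<close>

text \<open>
  The weight of \<open>\<bar>c\<^sub>k\<bar>\<^sup>2\<close> in Carlson's bound for \<open>\<bar>c\<^sub>N\<bar>\<close>, where \<open>a\<close> stands for \<open>\<bar>c\<^sub>0\<bar>\<close>. It vanishes for
  \<open>2 k > N\<close>, so that one formula covers odd and even \<open>N\<close>.
\<close>
definition carlson_weight :: "real \<Rightarrow> nat \<Rightarrow> nat \<Rightarrow> real" where
  "carlson_weight a N k = (if 2 * k < N then 1 else if 2 * k = N then 1 / (1 + a) else 0)"

text \<open>
  Up to the phase of \<open>c\<^sub>N\<close>, the Toeplitz bound is applied to the unit vector \<open>e\<^sub>0\<close> plus the weighted
  conjugate coefficients in reversed order, and to the weighted coefficients plus \<open>e\<^sub>N\<close>. The pair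
  \<open>e\<^sub>0\<close>, \<open>e\<^sub>N\<close> produces \<open>c\<^sub>N\<close>, and each of the two mixed pairs produces the weighted sum of
  squares. The contribution of the remaining pair vanishes because the weights do for \<open>2 k > N\<close>,
  except for one term with the factor \<open>c\<^sub>0\<close> that comes from the middle index of an even \<open>N\<close>. The
  weight \<open>1 / (1 + a)\<close> minimises \<open>(1 + a) w\<^sup>2 - 2 w\<close>, the coefficient at that index; the weight
  \<open>1\<close> minimises \<open>w\<^sup>2 - 2 w\<close>, the coefficient at the smaller ones.
\<close>
theorem carlson_inequality:
  assumes f: "f \<in> class_B" and N: "N \<ge> 1"
  shows "norm (taylor_coeff f N) \<le>
           1 - (\<Sum>k<N. carlson_weight (norm (f 0)) N k * norm (taylor_coeff f k) ^ 2)"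
proof -
  define c where "c = taylor_coeff f"
  define a where "a = norm (c 0)"
  define w where "w = carlson_weight a N"
  \<comment> \<open>the phase of \<open>c N\<close>, which is arbitrary if \<open>c N = 0\<close>\<close>
  define e where "e = (if c N = 0 then 1 else sgn (c N))"
  have [simp]: "norm e = 1"
    by (simp add: e_def norm_sgn)
  have ee: "e * cnj e = 1" "cnj e * e = 1"
    using complex_norm_square[of e] by (simp_all add: mult.commute)
  have ce: "cnj e * c N = of_real (norm (c N))"
  proof -
    have "c N = e * of_real (norm (c N))"
      by (simp add: e_def sgn_div_norm scaleR_conv_of_real)
    then have "cnj e * c N = (cnj e * e) * of_real (norm (c N))"
      by (metis mult.assoc)
    then show ?thesis by (simp add: ee)
  qed
  have wN: "w N = 0"
    using N by (simp add: w_def carlson_weight_def)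
  have w_nonneg: "w k \<ge> 0" for k
    by (simp add: w_def carlson_weight_def a_def)
  have sq: "z * cnj z = of_real (norm z ^ 2)" "cnj z * z = of_real (norm z ^ 2)" for z
    using complex_norm_square[of z] by (simp_all add: mult.commute)
  define x where "x j = (if j = 0 then 1 else e * w (N - j) * cnj (c (N - j)))" for j
  define y where "y l = (if l = N then e else w l * c l)" for l
  define Q where "Q = (\<Sum>k<N. w k ^ 2 * norm (c k) ^ 2)"
  define P where "P = (\<Sum>k<N. w k * norm (c k) ^ 2)"
  define row where "row l = (\<Sum>j\<le>l. c (l - j) * x j * cnj (y l))" for l
  have reflect: "(\<Sum>j\<in>{1..N}. h (N - j)) = (\<Sum>k<N. h k)" for h :: "nat \<Rightarrow> 'b::comm_monoid_add"
    by (rule sum.reindex_bij_witness[of _ "\<lambda>k. N - k" "\<lambda>j. N - j"]) auto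
  have atMost_Suc0: "{..l} = insert 0 {1..l}" for l :: nat
    by auto
  have atMost_N: "{..N} = insert N {..<N}"
    by auto

  have norm_x: "(\<Sum>j\<le>N. norm (x j) ^ 2) = 1 + Q"
  proof -
    have "(\<Sum>j\<in>{1..N}. norm (x j) ^ 2) = (\<Sum>j\<in>{1..N}. w (N - j) ^ 2 * norm (c (N - j)) ^ 2)"
      by (rule sum.cong) (auto simp: x_def norm_mult power_mult_distrib)
    then show ?thesis
      using reflect[of "\<lambda>k. w k ^ 2 * norm (c k) ^ 2"]
      by (simp add: atMost_Suc0 Q_def) (simp add: x_def)
  qed
  have norm_y: "(\<Sum>l\<le>N. norm (y l) ^ 2) = 1 + Q"
    by (simp add: atMost_N Q_def y_def norm_mult power_mult_distrib)

  have row_N: "row N = of_real (norm (c N) + P)"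
  proof -
    have "(\<Sum>j\<in>{1..N}. c (N - j) * x j * cnj (y N))
        = (\<Sum>j\<in>{1..N}. of_real (w (N - j) * norm (c (N - j)) ^ 2))"
    proof (rule sum.cong)
      fix j assume "j \<in> {1..N}"
      then have "c (N - j) * x j * cnj (y N)
          = of_real (w (N - j)) * (c (N - j) * cnj (c (N - j))) * (e * cnj e)"
        by (simp add: x_def y_def)
      then show "c (N - j) * x j * cnj (y N) = of_real (w (N - j) * norm (c (N - j)) ^ 2)"
        by (simp only: sq ee) simp
    qed auto
    also have "\<dots> = of_real P"
      using reflect[of "\<lambda>k. complex_of_real (w k * norm (c k) ^ 2)"] by (simp add: P_def)
    finally show ?thesis
      using ce by (simp add: row_def atMost_Suc0) (simp add: x_def y_def mult.commute)
  qed

  have row_less: "w l * norm (c l) ^ 2 - (if 2 * l = N then a * w l ^ 2 * norm (c l) ^ 2 else 0)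
                    \<le> Re (row l)" if "l < N" for l
  proof -
    let ?t = "\<lambda>j. c (l - j) * x j * cnj (y l)"
    have first: "?t 0 = of_real (w l * norm (c l) ^ 2)"
      using that sq(1)[of "c l"] by (simp add: x_def y_def mult.left_commute mult.commute)
    \<comment> \<open>Both weights are nonzero only if \<open>N \<le> 2 j \<le> 2 l \<le> N\<close>.\<close>
    have zero: "?t j = 0" if j: "j \<in> {1..l}" "\<not> (2 * l = N \<and> j = l)" for j
    proof -
      have "w l = 0 \<or> w (N - j) = 0"
        using j \<open>l < N\<close> by (auto simp: w_def carlson_weight_def)
      then show ?thesis
        using j \<open>l < N\<close> by (auto simp: x_def y_def)
    qed
    show ?thesis
    proof (cases "2 * l = N")
      case False
      then have "(\<Sum>j\<in>{1..l}. ?t j) = 0"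
        using zero by (intro sum.neutral) auto
      then have "row l = ?t 0"
        by (simp add: row_def atMost_Suc0)
      then show ?thesis
        using first False by simp
    next
      case True
      then have l: "l \<ge> 1" "N - l = l"
        using N by auto
      have "(\<Sum>j\<in>{1..l}. ?t j) = (\<Sum>j\<in>{l}. ?t j)"
        by (rule sum.mono_neutral_right) (use zero l in auto)
      then have "row l = ?t 0 + ?t l"
        by (simp add: row_def atMost_Suc0)
      moreover have "- norm (?t l) \<le> Re (?t l)"
        using abs_Re_le_cmod[of "?t l"] by linarith
      moreover have "norm (?t l) = a * w l ^ 2 * norm (c l) ^ 2"
        using l w_nonneg[of l] that
        by (simp add: x_def y_def a_def norm_mult power2_eq_square)
      ultimately show ?thesis
        using first True by simp
    qed
  qed

  have "(\<Sum>l<N. w l * norm (c l) ^ 2 - (if 2 * l = N then a * w l ^ 2 * norm (c l) ^ 2 else 0))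
          \<le> (\<Sum>l<N. Re (row l))"
    by (intro sum_mono row_less) auto
  moreover have "norm (c N) + P + (\<Sum>l<N. Re (row l)) \<le> 1 + Q"
    using toeplitz_bound[OF f, where N = N and x = x and y = y] row_N
    by (simp add: norm_x norm_y flip: c_def row_def) (simp add: atMost_N)
  ultimately have "norm (c N) \<le> 1 + Q - P -
      (\<Sum>l<N. w l * norm (c l) ^ 2 - (if 2 * l = N then a * w l ^ 2 * norm (c l) ^ 2 else 0))"
    by linarith
  also have "\<dots> = 1 + (\<Sum>l<N. (w l ^ 2 - 2 * w l + (if 2 * l = N then a * w l ^ 2 else 0))
                              * norm (c l) ^ 2)"
    unfolding P_def Q_def
    by (simp add: sum.distrib sum_subtractf algebra_simps if_distrib[of "\<lambda>z. _ * z"]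
        sum_distrib_left cong: if_cong)
  also have "(\<Sum>l<N. (w l ^ 2 - 2 * w l + (if 2 * l = N then a * w l ^ 2 else 0)) * norm (c l) ^ 2)
           = (\<Sum>l<N. - (w l * norm (c l) ^ 2))"
  proof (rule sum.cong)
    fix l
    have "1 + a > 0"
      by (simp add: a_def add_pos_nonneg)
    then have "w l ^ 2 - 2 * w l + (if 2 * l = N then a * w l ^ 2 else 0) = - w l"
      by (simp add: w_def carlson_weight_def power2_eq_square divide_simps)
    then show "(w l ^ 2 - 2 * w l + (if 2 * l = N then a * w l ^ 2 else 0)) * norm (c l) ^ 2
        = - (w l * norm (c l) ^ 2)"
      by (simp only: mult_minus_left)
  qed auto
  finally show ?thesis
    by (simp add: sum_negf w_def a_def c_def)
qed

section \<open>The estimate of the remainder\<close>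

lemma sums_carlson_weight:
  assumes r: "0 \<le> r" "r < 1" and "a \<ge> 0" "k \<ge> 1"
  shows "(\<lambda>n. carlson_weight a (n + 2) k * r ^ (n + 2)) sums
           ((1 + a * r) / ((1 + a) * (1 - r)) * r ^ (2 * k))"
proof -
  have "(\<lambda>N. if N = 2 * k then r ^ (2 * k) / (1 + a) else 0) sums (r ^ (2 * k) / (1 + a))"
    using sums_single[of "2 * k" "\<lambda>_. r ^ (2 * k) / (1 + a)"] by simp
  moreover have "(\<lambda>N. if 2 * k < N then r ^ N else 0) sums (r ^ Suc (2 * k) / (1 - r))"
  proof -
    have "(\<lambda>n. r ^ Suc (2 * k) * r ^ n) sums (r ^ Suc (2 * k) * (1 / (1 - r)))"
      using r by (intro sums_mult geometric_sums) auto
    then have "(\<lambda>n. if 2 * k < n + Suc (2 * k) then r ^ (n + Suc (2 * k)) else 0)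
        sums (r ^ Suc (2 * k) / (1 - r))"
      by (simp add: power_add mult_ac)
    then show ?thesis
      by (subst (asm) sums_zero_iff_shift) auto
  qed
  ultimately have "(\<lambda>N. (if N = 2 * k then r ^ (2 * k) / (1 + a) else 0) +
      (if 2 * k < N then r ^ N else 0)) sums (r ^ (2 * k) / (1 + a) + r ^ Suc (2 * k) / (1 - r))"
    by (rule sums_add)
  moreover have "(if N = 2 * k then r ^ (2 * k) / (1 + a) else 0) + (if 2 * k < N then r ^ N else 0)
      = carlson_weight a N k * r ^ N" for N
    by (auto simp: carlson_weight_def)
  ultimately have "(\<lambda>N. carlson_weight a N k * r ^ N) sums
      (r ^ (2 * k) / (1 + a) + r ^ Suc (2 * k) / (1 - r))"
    by simp
  then have "(\<lambda>n. carlson_weight a (n + 2) k * r ^ (n + 2)) sums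
      (r ^ (2 * k) / (1 + a) + r ^ Suc (2 * k) / (1 - r))"
    by (subst sums_zero_iff_shift) (use \<open>k \<ge> 1\<close> in \<open>auto simp: carlson_weight_def\<close>)
  also have "r ^ (2 * k) / (1 + a) + r ^ Suc (2 * k) / (1 - r)
      = (1 + a * r) / ((1 + a) * (1 - r)) * r ^ (2 * k)"
    using r \<open>a \<ge> 0\<close> by (simp add: divide_simps) (simp add: algebra_simps)
  finally show ?thesis .
qed

theorem bohr_rest_le:
  assumes f: "f \<in> class_B" and r: "0 \<le> r" "r < 1"
  shows "bohr_rest f r \<le> (1 - norm (f 0) ^ 2) * (r ^ 2 / (1 - r))"
proof -
  define c where "c = taylor_coeff f"
  define a where "a = norm (f 0)"
  define C where "C = (1 + a * r) / ((1 + a) * (1 - r))"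
  have a0: "a \<ge> 0"
    by (simp add: a_def)
  have C0: "C \<ge> 0"
    using a0 r by (simp add: C_def)
  \<comment> \<open>Only finitely many squares are kept at first, so that a finite and an infinite sum are
      interchanged; afterwards \<open>K\<close> tends to infinity.\<close>
  have partial: "majorant_tail 2 f r + (\<Sum>k\<in>{1..K}. C * r ^ (2 * k) * norm (c k) ^ 2)
          \<le> (1 - a ^ 2) * (r ^ 2 / (1 - r))" for K
  proof (rule sums_le)
    show "(\<lambda>n. norm (c (n + 2)) * r ^ (n + 2) +
             (\<Sum>k\<in>{1..K}. carlson_weight a (n + 2) k * r ^ (n + 2) * norm (c k) ^ 2))
          sums (majorant_tail 2 f r + (\<Sum>k\<in>{1..K}. C * r ^ (2 * k) * norm (c k) ^ 2))"
      unfolding majorant_tail_def c_def C_def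
      by (intro sums_add sums_sum sums_mult2 sums_carlson_weight r a0
            summable_sums summable_majorant_tail[OF f]) auto
    have "(\<lambda>n. (1 - a ^ 2) * (r ^ 2 * r ^ n)) sums ((1 - a ^ 2) * (r ^ 2 * (1 / (1 - r))))"
      using r by (intro sums_mult geometric_sums) auto
    then show "(\<lambda>n. (1 - a ^ 2) * r ^ (n + 2)) sums ((1 - a ^ 2) * (r ^ 2 / (1 - r)))"
      by (simp add: power_add power2_eq_square mult_ac)
    fix n
    let ?v = "\<lambda>k. carlson_weight a (n + 2) k * norm (c k) ^ 2"
    have v0: "?v k \<ge> 0" for k
      using a0 by (simp add: carlson_weight_def)
    have "a ^ 2 + (\<Sum>k\<in>{1..K}. ?v k) = (\<Sum>k\<in>{0..K}. ?v k)"
      by (simp add: sum.atLeast_Suc_atMost[of 0] carlson_weight_def a_def c_def)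
    also have "\<dots> = (\<Sum>k\<in>{0..K} \<inter> {..<n + 2}. ?v k)"
      by (rule sum.mono_neutral_right) (auto simp: carlson_weight_def)
    also have "\<dots> \<le> (\<Sum>k<n + 2. ?v k)"
      by (rule sum_mono2) (use v0 in auto)
    finally have "norm (c (n + 2)) + (\<Sum>k\<in>{1..K}. ?v k) \<le> 1 - a ^ 2"
      using carlson_inequality[OF f, of "n + 2"] by (simp add: a_def c_def)
    then have "(norm (c (n + 2)) + (\<Sum>k\<in>{1..K}. ?v k)) * r ^ (n + 2) \<le> (1 - a ^ 2) * r ^ (n + 2)"
      using r by (intro mult_right_mono) auto
    then show "norm (c (n + 2)) * r ^ (n + 2) +
             (\<Sum>k\<in>{1..K}. carlson_weight a (n + 2) k * r ^ (n + 2) * norm (c k) ^ 2)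
          \<le> (1 - a ^ 2) * r ^ (n + 2)"
      by (simp only: distrib_left distrib_right sum_distrib_left sum_distrib_right mult_ac)
  qed
  have "summable (\<lambda>n. C * (norm (c (n + 1)) ^ 2 * r ^ (2 * (n + 1))))"
    unfolding c_def by (intro summable_mult summable_f0_norm_sq f r)
  moreover have "(\<Sum>n<K. C * (norm (c (n + 1)) ^ 2 * r ^ (2 * (n + 1))))
      \<le> (1 - a ^ 2) * (r ^ 2 / (1 - r)) - majorant_tail 2 f r" for K
  proof -
    have "(\<Sum>n<K. C * (norm (c (n + 1)) ^ 2 * r ^ (2 * (n + 1))))
        = (\<Sum>k\<in>{1..K}. C * r ^ (2 * k) * norm (c k) ^ 2)"
      by (rule sum.reindex_bij_witness[of _ "\<lambda>k. k - 1" "\<lambda>n. n + 1"]) (auto simp: mult_ac)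
    then show ?thesis
      using partial[of K] by simp
  qed
  ultimately have "(\<Sum>n. C * (norm (c (n + 1)) ^ 2 * r ^ (2 * (n + 1))))
      \<le> (1 - a ^ 2) * (r ^ 2 / (1 - r)) - majorant_tail 2 f r"
    by (rule suminf_le_const)
  moreover have "(\<Sum>n. C * (norm (c (n + 1)) ^ 2 * r ^ (2 * (n + 1)))) = C * f0_norm_sq f r"
    unfolding f0_norm_sq_def c_def by (intro suminf_mult summable_f0_norm_sq f r)
  ultimately show ?thesis
    by (simp add: bohr_rest_def Let_def C_def a_def)
qed

section \<open>Schwarz and Schwarz-Pick lemmas\<close>

lemma order_m_Schwarz:
  assumes f: "f \<in> class_B" and zero: "\<And>k. k < m \<Longrightarrow> (deriv ^^ k) f 0 = 0"
    and z: "norm z < 1"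
  shows "norm (f z) \<le> norm z ^ m"
proof -
  define c where "c = taylor_coeff f"
  \<comment> \<open>the holomorphic extension of \<open>f w / w ^ m\<close>\<close>
  define g where "g w = (if w = 0 then c m else f w / w ^ m)" for w
  have fg: "f w = w ^ m * g w" if "w \<noteq> 0" for w
    using that by (simp add: g_def)
  have "(\<lambda>n. c (n + m) * (w - 0) ^ n) sums g w" if "w \<in> ball 0 1" for w
  proof (cases "w = 0")
    case True
    then show ?thesis
      using powser_sums_zero[of "\<lambda>n. c (n + m)"] by (simp add: g_def)
  next
    case False
    have "(\<lambda>n. c n * w ^ n) sums f w"
      using that unfolding c_def by (intro taylor_coeff_sums f) auto
    then have "(\<lambda>n. c (n + m) * w ^ (n + m)) sums f w"
      by (subst sums_zero_iff_shift) (auto simp: zero c_def taylor_coeff_def)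
    then have "(\<lambda>n. c (n + m) * w ^ (n + m) / w ^ m) sums (f w / w ^ m)"
      by (rule sums_divide)
    then show ?thesis
      using False by (simp add: g_def power_add)
  qed
  then have g: "g holomorphic_on ball 0 1"
    by (rule power_series_holomorphic)
  have "norm (f z) * \<rho> ^ m \<le> norm z ^ m" if \<rho>: "norm z < \<rho>" "\<rho> < 1" for \<rho>
  proof -
    have "\<rho> > 0"
      using \<rho> norm_ge_zero[of z] by linarith
    have "norm (g z) \<le> 1 / \<rho> ^ m"
    proof (rule maximum_modulus_frontier[of g "ball 0 \<rho>"])
      show "g holomorphic_on interior (ball 0 \<rho>)"
        using \<rho> by (intro holomorphic_on_subset[OF g]) auto
      show "continuous_on (closure (ball 0 \<rho>)) g"
        using \<rho> \<open>\<rho> > 0\<close>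
        by (intro holomorphic_on_imp_continuous_on holomorphic_on_subset[OF g]) auto
      fix w :: complex assume "w \<in> frontier (ball 0 \<rho>)"
      then have w: "norm w = \<rho>"
        using \<open>\<rho> > 0\<close> by simp
      then have "w \<noteq> 0" "norm (f w) \<le> 1"
        using \<rho> \<open>\<rho> > 0\<close> by (auto intro!: class_B_norm_le[OF f])
      then show "norm (g w) \<le> 1 / \<rho> ^ m"
        using w \<open>\<rho> > 0\<close> by (simp add: g_def norm_divide norm_power divide_right_mono)
    qed (use \<rho> in auto)
    then have "norm (g z) * \<rho> ^ m \<le> 1"
      using \<open>\<rho> > 0\<close> by (simp add: field_simps)
    then have *: "norm z ^ m * (norm (g z) * \<rho> ^ m) \<le> norm z ^ m"
      by (intro mult_right_le_one_le) (use \<open>\<rho> > 0\<close> in auto)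
    show ?thesis
    proof (cases "z = 0")
      case True
      then show ?thesis
        using zero[of 0] class_B_norm_le[OF f z] by (cases m) auto
    next
      case False
      then show ?thesis
        using * by (simp add: fg norm_mult norm_power mult.assoc)
    qed
  qed
  then have "eventually (\<lambda>\<rho>. norm (f z) * \<rho> ^ m \<le> norm z ^ m) (at_left 1)"
    using z by (intro eventually_at_leftI[of "norm z"]) auto
  moreover have "((\<lambda>\<rho>. norm (f z) * \<rho> ^ m) \<longlongrightarrow> norm (f z) * 1 ^ m) (at_left 1)"
    by (intro tendsto_intros)
  ultimately have "norm (f z) * 1 ^ m \<le> norm z ^ m"
    by (intro tendsto_upperbound[of _ _ "at_left 1"]) auto
  then show ?thesis by simp
qed

lemma norm_moebius_identity:
  fixes z w :: complex
  shows "norm (1 - cnj w * z) ^ 2 - norm (z - w) ^ 2 = (1 - norm w ^ 2) * (1 - norm z ^ 2)"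
proof -
  have "complex_of_real (norm (1 - cnj w * z) ^ 2 - norm (z - w) ^ 2)
      = complex_of_real ((1 - norm w ^ 2) * (1 - norm z ^ 2))"
    unfolding of_real_diff of_real_mult of_real_1 complex_norm_square
    by (simp add: algebra_simps)
  then show ?thesis
    by (simp only: of_real_eq_iff)
qed

lemma moebius_denom_nonzero:
  fixes z w :: complex
  assumes "norm w < 1" "norm z \<le> 1"
  shows "1 - cnj w * z \<noteq> 0"
proof
  assume "1 - cnj w * z = 0"
  then have "norm (cnj w * z) = 1"
    by simp
  moreover have "norm (cnj w * z) \<le> norm w"
    using assms by (simp add: norm_mult mult_right_le_one_le)
  ultimately show False
    using assms by simp
qed

lemma norm_moebius_le_1:
  fixes z w :: complex
  assumes "norm w < 1" "norm z \<le> 1"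
  shows "norm ((z - w) / (1 - cnj w * z)) \<le> 1"
proof -
  have "norm (1 - cnj w * z) ^ 2 - norm (z - w) ^ 2 \<ge> 0"
    unfolding norm_moebius_identity using assms by (intro mult_nonneg_nonneg) (simp_all add: power_le_one)
  then have "norm (z - w) ^ 2 \<le> norm (1 - cnj w * z) ^ 2"
    by linarith
  then have "norm (z - w) \<le> norm (1 - cnj w * z)"
    by (rule power2_le_imp_le) (rule norm_ge_zero)
  then show ?thesis
    using moebius_denom_nonzero[OF assms] unfolding norm_divide zero_less_norm_iff[symmetric]
    by (subst divide_le_eq_1_pos)
qed

lemma norm_moebius_less_1:
  fixes z w :: complex
  assumes "norm w < 1" "norm z < 1"
  shows "norm ((z - w) / (1 - cnj w * z)) < 1"
proof -
  have "norm (1 - cnj w * z) ^ 2 - norm (z - w) ^ 2 > 0"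
    unfolding norm_moebius_identity using assms by (intro mult_pos_pos) (simp_all add: abs_square_less_1)
  then have "norm (z - w) ^ 2 < norm (1 - cnj w * z) ^ 2"
    by linarith
  then have "norm (z - w) < norm (1 - cnj w * z)"
    by (rule power2_less_imp_less) (rule norm_ge_zero)
  then show ?thesis
    using moebius_denom_nonzero[OF assms(1) less_imp_le[OF assms(2)]]
    unfolding norm_divide zero_less_norm_iff[symmetric]
    by (subst divide_less_eq_1_pos)
qed

lemma Schwarz_Pick_norm_le:
  assumes f: "f \<in> class_B" and u: "norm u < 1"
  shows "norm (f u) \<le> (norm u + norm (f 0)) / (1 + norm (f 0) * norm u)"
proof (cases "norm (f 0) = 1")
  case True
  moreover have "1 + norm u > 0"
    using norm_ge_zero[of u] by linarith
  ultimately show ?thesis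
    using class_B_norm_le[OF f u] by (simp add: add.commute)
next
  case False
  define a where "a = norm (f 0)"
  define x where "x = norm (f u)"
  define s where "s = norm u"
  have a: "0 \<le> a" "a < 1"
    using False class_B_norm_at_0_le_1[OF f] by (auto simp: a_def)
  have x: "0 \<le> x" "x \<le> 1"
    using class_B_norm_le[OF f u] by (auto simp: x_def)
  have s: "0 \<le> s" "s < 1"
    using u by (auto simp: s_def)
  let ?h = "\<lambda>z. (f z - f 0) / (1 - cnj (f 0) * f z)"
  have "?h holomorphic_on ball 0 1"
    using a class_B_norm_le[OF f]
    by (intro holomorphic_intros class_B_holomorphic[OF f] moebius_denom_nonzero) (auto simp: a_def)
  then have "?h \<in> class_B"
    using a class_B_norm_le[OF f] by (intro class_BI norm_moebius_le_1) (auto simp: a_def)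
  from order_m_Schwarz[OF this, of 1 u] u have "norm (?h u) \<le> s"
    by (simp add: s_def)
  then have "norm (f u - f 0) \<le> s * norm (1 - cnj (f 0) * f u)"
    using moebius_denom_nonzero[of "f 0" "f u"] a x
    by (simp add: norm_divide a_def x_def divide_le_eq)
  then have "norm (f u - f 0) ^ 2 \<le> (s * norm (1 - cnj (f 0) * f u)) ^ 2"
    by (rule power_mono) (rule norm_ge_zero)
  then have "(1 - s ^ 2) * norm (1 - cnj (f 0) * f u) ^ 2 \<le> (1 - a ^ 2) * (1 - x ^ 2)"
    using norm_moebius_identity[of "f 0" "f u"]
    by (simp add: a_def x_def algebra_simps power_mult_distrib)
  moreover have "(1 - s ^ 2) * (1 - a * x) ^ 2 \<le> (1 - s ^ 2) * norm (1 - cnj (f 0) * f u) ^ 2"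
  proof (intro mult_left_mono power_mono)
    show "1 - a * x \<le> norm (1 - cnj (f 0) * f u)"
      using norm_triangle_ineq2[of 1 "cnj (f 0) * f u"] by (simp add: norm_mult a_def x_def)
    show "0 \<le> 1 - a * x"
      using a x by (simp add: mult_le_one)
    show "0 \<le> 1 - s ^ 2"
      using s by (simp add: power_le_one)
  qed
  ultimately have "(1 - s ^ 2) * (1 - a * x) ^ 2 \<le> (1 - a ^ 2) * (1 - x ^ 2)"
    by linarith
  then have "(x - a) ^ 2 \<le> (s * (1 - a * x)) ^ 2"
    by (simp add: power2_eq_square algebra_simps)
  moreover have "0 \<le> s * (1 - a * x)"
    using a x s by (simp add: mult_le_one)
  ultimately have "x - a \<le> s * (1 - a * x)"
    using power2_le_imp_le by blast
  then have "x * (1 + a * s) \<le> s + a"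
    by (simp add: algebra_simps)
  moreover have "1 + a * s > 0"
    using a s by (simp add: add_pos_nonneg)
  ultimately show ?thesis
    by (simp add: pos_le_divide_eq a_def s_def x_def)
qed

text \<open>
  This is the case \<open>N = 1\<close> of Carlson's inequality for \<open>f\<close> composed with the disc automorphism that
  maps \<open>0\<close> to \<open>u\<close>. Constants of modulus \<open>1\<close> need no separate treatment.
\<close>
lemma Schwarz_Pick_deriv:
  assumes f: "f \<in> class_B" and u: "norm u < 1"
  shows "norm (deriv f u) * (1 - norm u ^ 2) \<le> 1 - norm (f u) ^ 2"
proof -
  define \<phi> where "\<phi> z = (z - (- u)) / (1 - cnj (- u) * z)" for z
  have \<phi>_less: "norm (\<phi> z) < 1" if "norm z < 1" for z
    using norm_moebius_less_1[of "- u" z] u that by (simp add: \<phi>_def)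
  have "\<phi> holomorphic_on ball 0 1"
    unfolding \<phi>_def using u by (intro holomorphic_intros moebius_denom_nonzero) auto
  then have "(f \<circ> \<phi>) holomorphic_on ball 0 1"
    using \<phi>_less by (intro holomorphic_on_compose_gen[OF _ class_B_holomorphic[OF f]]) auto
  then have "f \<circ> \<phi> \<in> class_B"
    using \<phi>_less class_B_norm_le[OF f] by (intro class_BI) auto
  from carlson_inequality[OF this, of 1]
  have *: "norm (deriv (f \<circ> \<phi>) 0) \<le> 1 - norm (f u) ^ 2"
    by (simp add: taylor_coeff_def carlson_weight_def \<phi>_def)
  have "(\<phi> has_field_derivative (1 - cnj u * u)) (at 0)"
    unfolding \<phi>_def by (auto intro!: derivative_eq_intros)
  moreover have "(f has_field_derivative deriv f u) (at (\<phi> 0))"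
    using holomorphic_derivI[OF class_B_holomorphic[OF f]] u by (simp add: \<phi>_def)
  ultimately have "((f \<circ> \<phi>) has_field_derivative deriv f u * (1 - cnj u * u)) (at 0)"
    by (intro DERIV_chain)
  then have "deriv (f \<circ> \<phi>) 0 = deriv f u * (1 - cnj u * u)"
    by (rule DERIV_imp_deriv)
  also have "1 - cnj u * u = of_real (1 - norm u ^ 2)"
    using complex_norm_square[of u] by (simp add: mult.commute)
  finally have "norm (deriv (f \<circ> \<phi>) 0) = norm (deriv f u) * \<bar>1 - norm u ^ 2\<bar>"
    by (simp only: norm_mult norm_of_real)
  moreover have "1 - norm u ^ 2 \<ge> 0"
    using u by (simp add: power_le_one)
  ultimately show ?thesis
    using * by simp
qed

section \<open>The inequalities between real numbers\<close>

text \<open>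
  In the next two lemmas \<open>x\<close>, \<open>d\<close> and \<open>s\<close> play the roles of \<open>\<bar>f(u)\<bar>\<close>, \<open>\<bar>f'(u)\<bar>\<close> and \<open>\<bar>u\<bar>\<close>
  for \<open>u = \<omega>(z)\<close>, and \<open>S\<close> that of \<open>r^m\<close>. The last hypothesis is the case \<open>a = 1\<close>, \<open>s = S\<close> of
  the inequality that is left when the factor \<open>1 - a\<close> or \<open>1 - a\<^sup>2\<close> is cancelled. It also makes
  \<open>s\<close> so small that the left-hand side, after the bound on \<open>d\<close> is inserted, does not decrease when
  \<open>x\<close> grows to the Schwarz-Pick bound \<open>x0\<close>.
\<close>
lemma real_bound_E:
  fixes a r s S x d :: real
  assumes a: "0 \<le> a" "a \<le> 1" and s: "0 \<le> s" "s \<le> S" and r: "0 \<le> r" "r < 1"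
    and x: "0 \<le> x" "x \<le> 1" "x \<le> (s + a) / (1 + a * s)" and d: "d * (1 - s ^ 2) \<le> 1 - x ^ 2"
    and G: "(1 + S) ^ 2 * (1 + 2 * (r ^ 2 / (1 - r))) \<le> 2"
  shows "x + s * d + (1 - a ^ 2) * (r ^ 2 / (1 - r)) \<le> 1"
proof -
  define q where "q = r ^ 2 / (1 - r)"
  define x0 where "x0 = (s + a) / (1 + a * s)"
  define D where "D = 1 + a * s"
  have q: "q \<ge> 0"
    using r by (simp add: q_def)
  have "(1 + s) ^ 2 * (1 + 2 * q) \<le> (1 + S) ^ 2 * (1 + 2 * q)"
    using s q by (intro mult_right_mono power_mono) auto
  then have G': "(1 + s) ^ 2 * (1 + 2 * q) \<le> 2"
    using G by (simp add: q_def)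
  moreover have "(1 + s) ^ 2 * (1 + 0) \<le> (1 + s) ^ 2 * (1 + 2 * q)"
    using q by (intro mult_left_mono) auto
  ultimately have s2: "2 * s \<le> 1 - s ^ 2"
    by (simp add: power2_eq_square algebra_simps)
  have "s < 1"
  proof (rule ccontr)
    assume "\<not> s < 1"
    then have "s ^ 2 \<ge> 1"
      by (simp add: one_le_power)
    then show False
      using s2 \<open>\<not> s < 1\<close> by linarith
  qed
  then have s1: "1 - s ^ 2 > 0"
    using s by (simp add: abs_square_less_1)
  have D: "D \<ge> 1" "D \<le> 1 + s"
    using a s by (auto simp: D_def mult_left_le_one_le)
  have x0: "x0 \<le> 1" "x \<le> x0"
  proof -
    have "(1 - a) * (1 - s) \<ge> 0"
      using a \<open>s < 1\<close> by simp
    then have "s + a \<le> D"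
      by (simp add: D_def algebra_simps)
    then show "x0 \<le> 1"
      using D by (simp add: x0_def flip: D_def)
  qed (use x in \<open>simp add: x0_def\<close>)
  have "d \<le> (1 - x ^ 2) / (1 - s ^ 2)"
    using d s1 by (simp add: pos_le_divide_eq)
  then have "x + s * d \<le> x + s * ((1 - x ^ 2) / (1 - s ^ 2))"
    using s by (intro add_left_mono mult_left_mono)
  also have "\<dots> \<le> x0 + s * ((1 - x0 ^ 2) / (1 - s ^ 2))"
  proof -
    have "s * (x0 + x) \<le> s * 2"
      using s x x0 by (intro mult_left_mono) auto
    then have "s * (x0 + x) / (1 - s ^ 2) \<le> 1"
      using s1 s2 by (simp add: mult.commute)
    then have "(x0 - x) * (1 - s * (x0 + x) / (1 - s ^ 2)) \<ge> 0"
      using x0 by (intro mult_nonneg_nonneg) auto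
    moreover have "(x0 - x) * (1 - s * (x0 + x) / (1 - s ^ 2))
       = x0 + s * ((1 - x0 ^ 2) / (1 - s ^ 2)) - (x + s * ((1 - x ^ 2) / (1 - s ^ 2)))"
      using s1 by (simp add: divide_simps) (simp add: power2_eq_square algebra_simps)
    ultimately show ?thesis
      by linarith
  qed
  also have "x0 + s * ((1 - x0 ^ 2) / (1 - s ^ 2)) = 1 - (1 - a) * ((1 - 2 * s - a * s ^ 2) / D ^ 2)"
  proof -
    have "1 - x0 ^ 2 = (1 - a ^ 2) * (1 - s ^ 2) / D ^ 2"
      using D unfolding x0_def D_def
      by (simp add: divide_simps) (simp add: power2_eq_square algebra_simps)
    then have "x0 + s * ((1 - x0 ^ 2) / (1 - s ^ 2)) = (s + a) / D + s * ((1 - a ^ 2) / D ^ 2)"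
      using s1 by (simp add: x0_def D_def)
    also have "\<dots> = 1 - (1 - a) * ((1 - 2 * s - a * s ^ 2) / D ^ 2)"
      using D by (simp add: divide_simps) (simp add: D_def power2_eq_square algebra_simps)
    finally show ?thesis .
  qed
  finally have "x + s * d \<le> 1 - (1 - a) * ((1 - 2 * s - a * s ^ 2) / D ^ 2)" .
  moreover have "(1 + a) * q \<le> (1 - 2 * s - a * s ^ 2) / D ^ 2"
  proof -
    have "(1 + a) * q * D ^ 2 \<le> 2 * q * (1 + s) ^ 2"
      using a q D by (intro mult_mono power_mono) auto
    also have "\<dots> \<le> 1 - 2 * s - s ^ 2"
      using G' by (simp add: power2_eq_square algebra_simps)
    also have "\<dots> \<le> 1 - 2 * s - a * s ^ 2"
      using a by (simp add: mult_left_le_one_le)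
    finally show ?thesis
      using D by (simp add: pos_le_divide_eq)
  qed
  then have "(1 - a) * ((1 + a) * q) \<le> (1 - a) * ((1 - 2 * s - a * s ^ 2) / D ^ 2)"
    using a by (intro mult_left_mono) auto
  moreover have "(1 - a ^ 2) * q = (1 - a) * ((1 + a) * q)"
    by (simp add: power2_eq_square algebra_simps)
  ultimately show ?thesis
    unfolding q_def[symmetric] by linarith
qed

lemma real_bound_F:
  fixes a r s S x d :: real
  assumes a: "0 \<le> a" "a \<le> 1" and s: "0 \<le> s" "s \<le> S" "s < 1" and r: "0 \<le> r" "r < 1"
    and x: "0 \<le> x" "x \<le> (s + a) / (1 + a * s)" and d: "d * (1 - s ^ 2) \<le> 1 - x ^ 2"
    and H: "S ^ 2 + S - 1 + r ^ 2 / (1 - r) * (1 + S) ^ 2 \<le> 0"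
  shows "x ^ 2 + s * d + (1 - a ^ 2) * (r ^ 2 / (1 - r)) \<le> 1"
proof -
  define q where "q = r ^ 2 / (1 - r)"
  define x0 where "x0 = (s + a) / (1 + a * s)"
  define D where "D = 1 + a * s"
  have q: "q \<ge> 0"
    using r by (simp add: q_def)
  have "s ^ 2 + s - 1 + q * (1 + s) ^ 2 \<le> S ^ 2 + S - 1 + q * (1 + S) ^ 2"
    using s q by (intro add_mono diff_right_mono mult_left_mono power_mono) auto
  then have H': "q * (1 + s) ^ 2 \<le> 1 - s ^ 2 - s"
    using H by (simp add: q_def)
  moreover have "q * (1 + s) ^ 2 \<ge> 0"
    using q by simp
  ultimately have s2: "s \<le> 1 - s ^ 2"
    by linarith
  have s1: "1 - s ^ 2 > 0"
    using s by (simp add: abs_square_less_1)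
  have D: "D \<ge> 1" "D \<le> 1 + s"
    using a s by (auto simp: D_def mult_left_le_one_le)
  have "d \<le> (1 - x ^ 2) / (1 - s ^ 2)"
    using d s1 by (simp add: pos_le_divide_eq)
  then have "x ^ 2 + s * d \<le> x ^ 2 + s * ((1 - x ^ 2) / (1 - s ^ 2))"
    using s by (intro add_left_mono mult_left_mono)
  also have "\<dots> = 1 - (1 - x ^ 2) * (1 - s / (1 - s ^ 2))"
    by (simp add: field_simps)
  also have "\<dots> \<le> 1 - (1 - x0 ^ 2) * (1 - s / (1 - s ^ 2))"
  proof (intro diff_left_mono mult_right_mono)
    show "x ^ 2 \<le> x0 ^ 2"
      using x by (intro power_mono) (auto simp: x0_def)
    show "0 \<le> 1 - s / (1 - s ^ 2)"
      using s1 s2 by simp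
  qed
  also have "\<dots> = 1 - (1 - a ^ 2) * ((1 - s ^ 2 - s) / D ^ 2)"
  proof -
    have "1 - x0 ^ 2 = (1 - a ^ 2) * (1 - s ^ 2) / D ^ 2"
      using D unfolding x0_def D_def
      by (simp add: divide_simps) (simp add: power2_eq_square algebra_simps)
    moreover have "(1 - s ^ 2) * (1 - s / (1 - s ^ 2)) = 1 - s ^ 2 - s"
      using s1 by (simp add: right_diff_distrib)
    moreover have "A * B / C * T = A * ((B * T) / C)" for A B C T :: real
      by simp
    ultimately show ?thesis
      by (simp only:)
  qed
  finally have "x ^ 2 + s * d \<le> 1 - (1 - a ^ 2) * ((1 - s ^ 2 - s) / D ^ 2)" .
  moreover have "q \<le> (1 - s ^ 2 - s) / D ^ 2"
  proof -
    have "q * D ^ 2 \<le> q * (1 + s) ^ 2"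
      using q D by (intro mult_mono power_mono) auto
    then show ?thesis
      using D H' by (simp add: pos_le_divide_eq)
  qed
  then have "(1 - a ^ 2) * q \<le> (1 - a ^ 2) * ((1 - s ^ 2 - s) / D ^ 2)"
    using a by (intro mult_left_mono) (auto simp: power_le_one)
  ultimately show ?thesis
    unfolding q_def[symmetric] by linarith
qed

section \<open>The roots\<close>

text \<open>
  Two representations of one sign: \<open>G\<close> is continuous up to the endpoint \<open>1\<close>, where \<open>h\<close> need not be,
  and has a zero by the intermediate value theorem; the monotone \<open>h\<close> supplies uniqueness and the
  sign pattern.
\<close>
lemma unique_sign_change:
  fixes G h :: "real \<Rightarrow> real"
  assumes cont: "continuous_on {0..1} G"
    and G0: "G 0 < 0" and G1: "G 1 > 0"
    and Gh: "\<And>r. 0 \<le> r \<Longrightarrow> r < 1 \<Longrightarrow> G r = (1 - r) * h r"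
    and mono: "strict_mono_on {0..<1} h"
  obtains \<gamma> where "{r \<in> {0<..<1}. G r = 0} = {\<gamma>}" "0 < \<gamma>" "\<gamma> < 1"
    "\<And>r. 0 \<le> r \<Longrightarrow> r \<le> \<gamma> \<Longrightarrow> h r \<le> 0" "\<And>r. \<gamma> < r \<Longrightarrow> r < 1 \<Longrightarrow> h r > 0"
proof -
  have "\<exists>\<gamma>\<ge>0. \<gamma> \<le> 1 \<and> G \<gamma> = 0"
    by (rule IVT'[where f = G]) (use cont G0 G1 in simp_all)
  then obtain \<gamma> where \<gamma>: "0 \<le> \<gamma>" "\<gamma> \<le> 1" "G \<gamma> = 0"
    by blast
  have "\<gamma> \<noteq> 0" "\<gamma> \<noteq> 1"
    using \<gamma>(3) G0 G1 by auto
  then have \<gamma>': "0 < \<gamma>" "\<gamma> < 1"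
    using \<gamma> by linarith+
  have h0: "h r = 0" if "0 < r" "r < 1" "G r = 0" for r
  proof -
    have "(1 - r) * h r = 0"
      using Gh[OF less_imp_le[OF that(1)] that(2)] that(3) by metis
    then show ?thesis
      using that(2) by simp
  qed
  have h\<gamma>: "h \<gamma> = 0"
    by (rule h0) fact+
  have neg: "h r < 0" if "0 \<le> r" "r < \<gamma>" for r
  proof -
    have "r \<in> {0..<1}" "\<gamma> \<in> {0..<1}"
      using that \<gamma>' by simp_all
    from strict_mono_onD[OF mono this that(2)] show ?thesis
      by (simp only: h\<gamma>)
  qed
  have pos: "h r > 0" if "\<gamma> < r" "r < 1" for r
  proof -
    have "\<gamma> \<in> {0..<1}" "r \<in> {0..<1}"
      using that \<gamma>' by simp_all
    from strict_mono_onD[OF mono this that(1)] show ?thesis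
      by (simp only: h\<gamma>)
  qed
  have unique: "r = \<gamma>" if "0 < r" "r < 1" "G r = 0" for r
  proof (cases r \<gamma> rule: linorder_cases)
    case less
    then show ?thesis
      using neg[of r] h0[OF that] that(1) by linarith
  next
    case greater
    then show ?thesis
      using pos[of r] h0[OF that] that(2) by linarith
  qed
  have root: "{r \<in> {0<..<1}. G r = 0} = {\<gamma>}"
  proof (intro set_eqI iffI)
    fix r assume "r \<in> {r \<in> {0<..<1}. G r = 0}"
    then show "r \<in> {\<gamma>}"
      using unique[of r] by simp
  next
    fix r assume "r \<in> {\<gamma>}"
    then show "r \<in> {r \<in> {0<..<1}. G r = 0}"
      using \<gamma>(3) \<gamma>' by simp
  qed
  have nonpos: "h r \<le> 0" if "0 \<le> r" "r \<le> \<gamma>" for r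
    using neg[OF that(1)] h\<gamma> that(2) by (cases "r = \<gamma>") simp_all
  show ?thesis
    by (rule that[OF root \<gamma>' nonpos pos])
qed

lemma square_div_mono:
  fixes x y :: real
  assumes "0 \<le> x" "x \<le> y" "y < 1"
  shows "x ^ 2 / (1 - x) \<le> y ^ 2 / (1 - y)"
  using assms by (intro frac_le power_mono) auto

lemma strict_mono_gamma:
  assumes "m \<ge> 1"
  shows "strict_mono_on {0..<1::real} (\<lambda>r. (1 + r ^ m) ^ 2 * (1 + 2 * (r ^ 2 / (1 - r))) - 2)"
proof (rule strict_mono_onI)
  fix x y :: real
  assume "x \<in> {0..<1}" "y \<in> {0..<1}" "x < y"
  then have xy: "0 \<le> x" "x < y" "y < 1"
    by auto
  have "(1 + x ^ m) ^ 2 * (1 + 2 * (x ^ 2 / (1 - x))) < (1 + y ^ m) ^ 2 * (1 + 2 * (y ^ 2 / (1 - y)))"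
  proof (rule mult_less_le_imp_less)
    show "(1 + x ^ m) ^ 2 < (1 + y ^ m) ^ 2"
      using xy assms power_strict_mono[of x y m]
      by (intro power_strict_mono[of "1 + x ^ m"]) auto
    show "1 + 2 * (x ^ 2 / (1 - x)) \<le> 1 + 2 * (y ^ 2 / (1 - y))"
      using square_div_mono[of x y] xy by simp
    have "x ^ 2 / (1 - x) \<ge> 0"
      using xy by simp
    then show "0 < 1 + 2 * (x ^ 2 / (1 - x))"
      by linarith
  qed auto
  then show "(1 + x ^ m) ^ 2 * (1 + 2 * (x ^ 2 / (1 - x))) - 2
      < (1 + y ^ m) ^ 2 * (1 + 2 * (y ^ 2 / (1 - y))) - 2"
    by linarith
qed

lemma strict_mono_delta:
  assumes "m \<ge> 1"
  shows "strict_mono_on {0..<1::real} (\<lambda>r. (r ^ m) ^ 2 + r ^ m - 1 + r ^ 2 / (1 - r) * (1 + r ^ m) ^ 2)"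
proof (rule strict_mono_onI)
  fix x y :: real
  assume "x \<in> {0..<1}" "y \<in> {0..<1}" "x < y"
  then have xy: "0 \<le> x" "x < y" "y < 1"
    by auto
  have s: "0 \<le> x ^ m" "x ^ m < y ^ m"
    using power_strict_mono[of x y m] xy assms by auto
  have "(x ^ m) ^ 2 \<le> (y ^ m) ^ 2"
    by (rule power_mono) (use s in auto)
  moreover have "x ^ 2 / (1 - x) * (1 + x ^ m) ^ 2 \<le> y ^ 2 / (1 - y) * (1 + y ^ m) ^ 2"
  proof (rule mult_mono)
    show "x ^ 2 / (1 - x) \<le> y ^ 2 / (1 - y)"
      using square_div_mono[of x y] xy by simp
    show "(1 + x ^ m) ^ 2 \<le> (1 + y ^ m) ^ 2"
      using s by (intro power_mono) auto
  qed (use xy in auto)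
  ultimately show "(x ^ m) ^ 2 + x ^ m - 1 + x ^ 2 / (1 - x) * (1 + x ^ m) ^ 2
      < (y ^ m) ^ 2 + y ^ m - 1 + y ^ 2 / (1 - y) * (1 + y ^ m) ^ 2"
    using s by linarith
qed

section \<open>The extremal functions\<close>

text \<open>
  The disc automorphism \<open>z \<mapsto> (z + a) / (1 + a z)\<close>, meant for \<open>0 < a < 1\<close>. The sign of \<open>a\<close> in the
  numerator is chosen so that the values at points \<open>s \<ge> 0\<close> attain the Schwarz-Pick bound.
\<close>
definition extremal :: "real \<Rightarrow> complex \<Rightarrow> complex" where
  "extremal a z = (z + of_real a) / (1 + of_real a * z)"

lemma extremal_denom_nonzero:
  fixes z :: complex
  assumes "0 < a" "a < 1" "norm z < 1"
  shows "1 + of_real a * z \<noteq> 0"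
  using moebius_denom_nonzero[of "- of_real a" z] assms by simp

lemma extremal_in_class_B:
  assumes "0 < a" "a < 1"
  shows "extremal a \<in> class_B"
proof (rule class_BI)
  show "extremal a holomorphic_on ball 0 1"
    unfolding extremal_def using assms
    by (intro holomorphic_intros extremal_denom_nonzero) auto
  fix z :: complex assume "norm z < 1"
  then show "norm (extremal a z) \<le> 1"
    using norm_moebius_le_1[of "- of_real a" z] assms by (simp add: extremal_def)
qed

lemma taylor_coeff_extremal:
  assumes a: "0 < a" "a < 1"
  shows "taylor_coeff (extremal a) (Suc n) = (1 - of_real a ^ 2) * (- of_real a) ^ n"
proof -
  define F where "F = Abs_fps (\<lambda>n. case n of 0 \<Rightarrow> complex_of_real a
                         | Suc k \<Rightarrow> (1 - of_real a ^ 2) * (- of_real a) ^ k)"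
  have "extremal a has_fps_expansion F"
  proof (rule has_fps_expansionI)
    have "(\<lambda>n. fps_nth F n * u ^ n) sums extremal a u" if u: "norm u < 1" for u
    proof -
      have "norm (- of_real a * u) < 1"
      proof -
        have "norm (- of_real a * u) \<le> norm u"
          using a by (simp add: norm_mult mult_left_le_one_le)
        then show ?thesis
          using u by linarith
      qed
      then have "(\<lambda>n. (1 - of_real a ^ 2) * u * (- of_real a * u) ^ n) sums
          ((1 - of_real a ^ 2) * u * (1 / (1 - (- of_real a * u))))"
        by (intro sums_mult geometric_sums)
      moreover have "(1 - of_real a ^ 2) * u * (- of_real a * u) ^ n = fps_nth F (Suc n) * u ^ Suc n" for n
        unfolding power_mult_distrib by (simp add: F_def)
      ultimately have "(\<lambda>n. fps_nth F (Suc n) * u ^ Suc n) sums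
          ((1 - of_real a ^ 2) * u * (1 / (1 - (- of_real a * u))))"
        by (simp only:)
      then have "(\<lambda>n. fps_nth F (Suc n) * u ^ Suc n) sums
          ((1 - of_real a ^ 2) * u / (1 + of_real a * u))"
        by simp
      from sums_Suc[OF this] have "(\<lambda>n. fps_nth F n * u ^ n) sums
          ((1 - of_real a ^ 2) * u / (1 + of_real a * u) + of_real a)"
        by (simp add: F_def)
      also have "(1 - of_real a ^ 2) * u / (1 + of_real a * u) + of_real a = extremal a u"
        using extremal_denom_nonzero[OF a u]
        by (simp add: extremal_def field_simps power2_eq_square)
      finally show ?thesis .
    qed
    then show "\<forall>\<^sub>F u in nhds 0. (\<lambda>n. fps_nth F n * u ^ n) sums extremal a u"
      by (auto simp: eventually_nhds_metric intro!: exI[of _ 1])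
  qed
  then show ?thesis
    using fps_nth_fps_expansion[of "extremal a" F "Suc n"] by (simp add: taylor_coeff_def F_def)
qed

lemma norm_taylor_coeff_extremal:
  assumes a: "0 < a" "a < 1"
  shows "norm (taylor_coeff (extremal a) (Suc n)) = (1 - a ^ 2) * a ^ n"
proof -
  have "norm (1 - complex_of_real a ^ 2) = \<bar>1 - a ^ 2\<bar>"
    by (metis norm_of_real of_real_1 of_real_diff of_real_power)
  then show ?thesis
    using a by (simp add: taylor_coeff_extremal norm_mult norm_power power_le_one)
qed

text \<open>Equality holds in the estimate \<open>bohr_rest_le\<close>.\<close>
lemma bohr_rest_extremal:
  assumes a: "0 < a" "a < 1" and r: "0 \<le> r" "r < 1"
  shows "bohr_rest (extremal a) r = (1 - a ^ 2) * (r ^ 2 / (1 - r))"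
proof -
  have ar: "0 \<le> a * r" "a * r < 1"
    using a r mult_strict_mono[of a 1 r 1] by auto
  have "(\<lambda>n. (1 - a ^ 2) * a * r ^ 2 * (a * r) ^ n) sums
          ((1 - a ^ 2) * a * r ^ 2 * (1 / (1 - a * r)))"
    using ar by (intro sums_mult geometric_sums) auto
  also have "(\<lambda>n. (1 - a ^ 2) * a * r ^ 2 * (a * r) ^ n)
      = (\<lambda>n. norm (taylor_coeff (extremal a) (n + 2)) * r ^ (n + 2))"
  proof
    fix n
    show "(1 - a ^ 2) * a * r ^ 2 * (a * r) ^ n
        = norm (taylor_coeff (extremal a) (n + 2)) * r ^ (n + 2)"
      using norm_taylor_coeff_extremal[OF a, of "Suc n"]
      by (simp add: power_mult_distrib power2_eq_square mult_ac)
  qed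
  finally have tail: "majorant_tail 2 (extremal a) r = (1 - a ^ 2) * a * r ^ 2 * (1 / (1 - a * r))"
    unfolding majorant_tail_def by (rule sums_unique[symmetric])
  have "(a * r) ^ 2 < 1"
    using ar by (simp add: abs_square_less_1)
  then have "(\<lambda>n. (1 - a ^ 2) ^ 2 * r ^ 2 * ((a * r) ^ 2) ^ n) sums
          ((1 - a ^ 2) ^ 2 * r ^ 2 * (1 / (1 - (a * r) ^ 2)))"
    by (intro sums_mult geometric_sums) auto
  also have "(\<lambda>n. (1 - a ^ 2) ^ 2 * r ^ 2 * ((a * r) ^ 2) ^ n)
      = (\<lambda>n. norm (taylor_coeff (extremal a) (n + 1)) ^ 2 * r ^ (2 * (n + 1)))"
  proof
    fix n
    have "((a * r) ^ 2) ^ n = (a ^ n) ^ 2 * (r ^ n) ^ 2"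
      by (simp add: power_mult_distrib mult.commute flip: power_mult)
    moreover have "r ^ (2 * (n + 1)) = (r ^ n) ^ 2 * r ^ 2"
    proof -
      have "2 * (n + 1) = n * 2 + 2"
        by simp
      then show ?thesis
        by (simp only: power_add power_mult)
    qed
    moreover have "norm (taylor_coeff (extremal a) (n + 1)) ^ 2 = (1 - a ^ 2) ^ 2 * (a ^ n) ^ 2"
      using norm_taylor_coeff_extremal[OF a, of n] by (simp add: power_mult_distrib)
    ultimately show "(1 - a ^ 2) ^ 2 * r ^ 2 * ((a * r) ^ 2) ^ n
        = norm (taylor_coeff (extremal a) (n + 1)) ^ 2 * r ^ (2 * (n + 1))"
      by (simp only: mult_ac)
  qed
  finally have norm_sq: "f0_norm_sq (extremal a) r = (1 - a ^ 2) ^ 2 * r ^ 2 * (1 / (1 - (a * r) ^ 2))"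
    unfolding f0_norm_sq_def by (rule sums_unique[symmetric])
  have "norm (taylor_coeff (extremal a) 0) = a"
    using a by (simp add: extremal_def)
  then have "bohr_rest (extremal a) r = (1 - a ^ 2) * a * r ^ 2 * (1 / (1 - a * r)) +
      (1 + a * r) / ((1 + a) * (1 - r)) * ((1 - a ^ 2) ^ 2 * r ^ 2 * (1 / (1 - (a * r) ^ 2)))"
    by (simp only: bohr_rest_def Let_def tail norm_sq)
  also have "\<dots> = (1 - a ^ 2) * r ^ 2 * (a / (1 - a * r) +
      (1 + a * r) / ((1 + a) * (1 - r)) * ((1 - a ^ 2) / (1 - (a * r) ^ 2)))"
  proof -
    have "K * a * P * (1 / d) + c * (K ^ 2 * P * (1 / e)) = K * P * (a / d + c * (K / e))"
      for K P c d e :: real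
      by (simp add: power2_eq_square distrib_left mult_ac)
    then show ?thesis .
  qed
  also have "(1 + a * r) / ((1 + a) * (1 - r)) * ((1 - a ^ 2) / (1 - (a * r) ^ 2))
      = (1 - a) / ((1 - r) * (1 - a * r))"
  proof -
    have "1 - a ^ 2 = (1 + a) * (1 - a)" "1 - (a * r) ^ 2 = (1 + a * r) * (1 - a * r)"
      by (simp_all add: power2_eq_square algebra_simps)
    then have "(1 + a * r) / ((1 + a) * (1 - r)) * ((1 - a ^ 2) / (1 - (a * r) ^ 2))
       = ((1 + a) * (1 + a * r) * (1 - a)) / ((1 + a) * (1 + a * r) * ((1 - r) * (1 - a * r)))"
      by (simp only: times_divide_times_eq mult_ac)
    then show ?thesis
      using a ar by simp
  qed
  also have "a / (1 - a * r) + (1 - a) / ((1 - r) * (1 - a * r)) = 1 / (1 - r)"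
    using r ar by (simp add: divide_simps) (simp add: algebra_simps)
  finally show ?thesis
    by simp
qed

lemma norm_extremal_of_real:
  assumes "0 < a" "a < 1" "0 \<le> s" "s < 1"
  shows "norm (extremal a (of_real s)) = (s + a) / (1 + a * s)"
proof -
  have "extremal a (of_real s) = of_real ((s + a) / (1 + a * s))"
    by (simp add: extremal_def)
  then show ?thesis
    using assms by (simp del: of_real_divide of_real_add add: norm_of_real)
qed

lemma norm_deriv_extremal_of_real:
  assumes a: "0 < a" "a < 1" and s: "0 \<le> s" "s < 1"
  shows "norm (deriv (extremal a) (of_real s)) = (1 - a ^ 2) / (1 + a * s) ^ 2"
proof -
  have "1 + complex_of_real a * of_real s \<noteq> 0"
    using a s by (intro extremal_denom_nonzero) auto
  then have "(extremal a has_field_derivative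
      ((1 + of_real a * of_real s) - (of_real s + of_real a) * of_real a)
        / ((1 + of_real a * of_real s) * (1 + of_real a * of_real s))) (at (of_real s))"
    unfolding extremal_def by (auto intro!: derivative_eq_intros)
  then have "deriv (extremal a) (of_real s) =
      of_real (((1 + a * s) - (s + a) * a) / ((1 + a * s) * (1 + a * s)))"
    by (simp add: DERIV_imp_deriv)
  also have "((1 + a * s) - (s + a) * a) / ((1 + a * s) * (1 + a * s)) = (1 - a ^ 2) / (1 + a * s) ^ 2"
    by (simp add: power2_eq_square algebra_simps)
  finally have "norm (deriv (extremal a) (of_real s)) = \<bar>(1 - a ^ 2) / (1 + a * s) ^ 2\<bar>"
    by (simp only: norm_of_real)
  moreover have "(1 - a ^ 2) / (1 + a * s) ^ 2 \<ge> 0"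
    using a by (simp add: power_le_one)
  ultimately show ?thesis
    by (simp only: abs_of_nonneg)
qed

lemma power_in_class_Bm:
  assumes "m \<ge> 1"
  shows "(\<lambda>z. z ^ m) \<in> class_Bm m"
proof -
  have "(\<lambda>z::complex. z ^ m) \<in> class_B"
    by (intro class_BI holomorphic_intros) (simp add: norm_power power_le_one)
  moreover have "(deriv ^^ k) (\<lambda>z::complex. z ^ m) 0 = (if k = m then fact m else 0)" for k
    using fps_nth_fps_expansion[OF has_fps_expansion_fps_X_power[of m], of k]
    by (simp add: fps_X_power_nth field_simps split: if_splits)
  ultimately show ?thesis
    by (simp add: class_Bm_def)
qed

section \<open>The two Bohr inequalities and their sharpness\<close>

lemma class_Bm_norm_le:
  assumes "\<omega> \<in> class_Bm m" "norm z < 1"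
  shows "norm (\<omega> z) \<le> norm z ^ m"
  using assms by (intro order_m_Schwarz) (auto simp: class_Bm_def)

lemma bohr_E_le_1:
  assumes f: "f \<in> class_B" and \<omega>: "\<omega> \<in> class_Bm m" and m: "m \<ge> 1"
    and r: "norm z = r" "r < 1"
    and h: "(1 + r ^ m) ^ 2 * (1 + 2 * (r ^ 2 / (1 - r))) - 2 \<le> 0"
  shows "bohr_E f \<omega> z \<le> 1"
proof -
  let ?u = "\<omega> z"
  have r0: "r \<ge> 0"
    using r by auto
  have u: "norm ?u \<le> r ^ m"
    using class_Bm_norm_le[OF \<omega>] r by blast
  have "r ^ m < 1"
    using r0 r m by (simp add: power_less_one_iff)
  then have u1: "norm ?u < 1"
    using u by linarith
  have "norm (f ?u) + norm ?u * norm (deriv f ?u) + (1 - norm (f 0) ^ 2) * (r ^ 2 / (1 - r)) \<le> 1"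
    using h
    by (intro real_bound_E[where S = "r ^ m"] Schwarz_Pick_norm_le Schwarz_Pick_deriv
          class_B_norm_le class_B_norm_at_0_le_1 f u1 u r0 r(2)) auto
  then show ?thesis
    using bohr_rest_le[OF f r0 r(2)] r(1) by (simp add: bohr_E_def)
qed

lemma bohr_F_le_1:
  assumes f: "f \<in> class_B" and \<omega>: "\<omega> \<in> class_Bm m" and m: "m \<ge> 1"
    and r: "norm z = r" "r < 1"
    and h: "(r ^ m) ^ 2 + r ^ m - 1 + r ^ 2 / (1 - r) * (1 + r ^ m) ^ 2 \<le> 0"
  shows "bohr_F f \<omega> z \<le> 1"
proof -
  let ?u = "\<omega> z"
  have r0: "r \<ge> 0"
    using r by auto
  have u: "norm ?u \<le> r ^ m"
    using class_Bm_norm_le[OF \<omega>] r by blast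
  have "r ^ m < 1"
    using r0 r m by (simp add: power_less_one_iff)
  then have u1: "norm ?u < 1"
    using u by linarith
  have "norm (f ?u) ^ 2 + norm ?u * norm (deriv f ?u) + (1 - norm (f 0) ^ 2) * (r ^ 2 / (1 - r)) \<le> 1"
    using h
    by (intro real_bound_F[where S = "r ^ m"] Schwarz_Pick_norm_le Schwarz_Pick_deriv
          class_B_norm_at_0_le_1 f u1 u r0 r(2)) auto
  then show ?thesis
    using bohr_rest_le[OF f r0 r(2)] r(1) by (simp add: bohr_F_def)
qed

lemma bohr_E_sharp:
  assumes m: "m \<ge> 1" and r: "0 < r" "r < 1"
    and h: "(1 + r ^ m) ^ 2 * (1 + 2 * (r ^ 2 / (1 - r))) - 2 > 0"
  shows "\<exists>f\<in>class_B. bohr_E f (\<lambda>z. z ^ m) (of_real r) > 1"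
proof -
  define s where "s = r ^ m"
  define q where "q = r ^ 2 / (1 - r)"
  have s: "0 \<le> s" "s < 1"
    using r m by (auto simp: s_def power_less_one_iff)
  \<comment> \<open>The sign of \<open>?P a\<close> is the sign of the excess over \<open>1\<close> for the function \<open>extremal a\<close>.\<close>
  let ?P = "\<lambda>a. (1 + a) * q * (1 + a * s) ^ 2 - (1 - 2 * s - a * s ^ 2)"
  have "(?P \<longlongrightarrow> ?P 1) (at_left 1)"
    by (intro tendsto_intros)
  moreover have "?P 1 > 0"
    using h unfolding s_def[symmetric] q_def[symmetric] by (simp add: power2_eq_square algebra_simps)
  ultimately have "eventually (\<lambda>a. ?P a > 0) (at_left 1)"
    by (rule order_tendstoD)
  moreover have "eventually (\<lambda>a::real. 0 < a \<and> a < 1) (at_left 1)"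
    by (rule eventually_at_leftI[of 0]) auto
  ultimately obtain a where P: "?P a > 0" and a: "0 < a" "a < 1"
    using eventually_happens[OF eventually_conj] trivial_limit_at_left_real[of "1::real"] by blast
  define D where "D = 1 + a * s"
  have D: "D > 0"
    using a s by (simp add: D_def add_pos_nonneg)
  have "bohr_E (extremal a) (\<lambda>z. z ^ m) (of_real r)
      = (s + a) / D + s * ((1 - a ^ 2) / D ^ 2) + (1 - a ^ 2) * q"
    using r norm_extremal_of_real[OF a s] norm_deriv_extremal_of_real[OF a s]
      bohr_rest_extremal[OF a, of r] s(1)
    by (simp add: bohr_E_def D_def q_def flip: of_real_power s_def)
  also have "\<dots> = 1 + (1 - a) / D ^ 2 * ?P a"
  proof -
    let ?R = "1 - 2 * s - a * s ^ 2"
    have "(s + a) / D + s * ((1 - a ^ 2) / D ^ 2) = ((s + a) * D + s * (1 - a ^ 2)) / D ^ 2"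
      using D by (simp add: field_simps power2_eq_square)
    also have "(s + a) * D + s * (1 - a ^ 2) = D ^ 2 - (1 - a) * ?R"
      by (simp add: D_def power2_eq_square algebra_simps)
    also have "\<dots> / D ^ 2 = 1 - (1 - a) / D ^ 2 * ?R"
    proof -
      have "(D ^ 2 - X * Y) / D ^ 2 = 1 - X / D ^ 2 * Y" for X Y
        using D by (simp add: diff_divide_distrib)
      then show ?thesis .
    qed
    finally have "(s + a) / D + s * ((1 - a ^ 2) / D ^ 2) = 1 - (1 - a) / D ^ 2 * ?R" .
    moreover have "(1 - a ^ 2) * q = (1 - a) / D ^ 2 * ((1 + a) * q * D ^ 2)"
    proof -
      have "(1 - a) / D ^ 2 * ((1 + a) * q * D ^ 2) = (1 - a) * ((1 + a) * q)"
        using D by simp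
      then show ?thesis
        by (simp add: power2_eq_square algebra_simps)
    qed
    ultimately show ?thesis
      unfolding D_def[symmetric] by (simp only: right_diff_distrib)
  qed
  also have "\<dots> > 1"
    using P a D by simp
  finally show ?thesis
    using extremal_in_class_B[OF a] by blast
qed

lemma bohr_F_sharp:
  assumes m: "m \<ge> 1" and r: "0 < r" "r < 1"
    and h: "(r ^ m) ^ 2 + r ^ m - 1 + r ^ 2 / (1 - r) * (1 + r ^ m) ^ 2 > 0"
  shows "\<exists>f\<in>class_B. bohr_F f (\<lambda>z. z ^ m) (of_real r) > 1"
proof -
  define s where "s = r ^ m"
  define q where "q = r ^ 2 / (1 - r)"
  have s: "0 \<le> s" "s < 1"
    using r m by (auto simp: s_def power_less_one_iff)
  \<comment> \<open>The sign of \<open>?P a\<close> is the sign of the excess over \<open>1\<close> for the function \<open>extremal a\<close>.\<close>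
  let ?P = "\<lambda>a. s ^ 2 + s - 1 + q * (1 + a * s) ^ 2"
  have "(?P \<longlongrightarrow> ?P 1) (at_left 1)"
    by (intro tendsto_intros)
  moreover have "?P 1 > 0"
    using h unfolding s_def[symmetric] q_def[symmetric] by simp
  ultimately have "eventually (\<lambda>a. ?P a > 0) (at_left 1)"
    by (rule order_tendstoD)
  moreover have "eventually (\<lambda>a::real. 0 < a \<and> a < 1) (at_left 1)"
    by (rule eventually_at_leftI[of 0]) auto
  ultimately obtain a where P: "?P a > 0" and a: "0 < a" "a < 1"
    using eventually_happens[OF eventually_conj] trivial_limit_at_left_real[of "1::real"] by blast
  define D where "D = 1 + a * s"
  have D: "D > 0"
    using a s by (simp add: D_def add_pos_nonneg)
  have "bohr_F (extremal a) (\<lambda>z. z ^ m) (of_real r)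
      = ((s + a) / D) ^ 2 + s * ((1 - a ^ 2) / D ^ 2) + (1 - a ^ 2) * q"
    using r norm_extremal_of_real[OF a s] norm_deriv_extremal_of_real[OF a s]
      bohr_rest_extremal[OF a, of r] s(1)
    by (simp add: bohr_F_def D_def q_def flip: of_real_power s_def)
  also have "\<dots> = 1 + (1 - a ^ 2) / D ^ 2 * ?P a"
    unfolding D_def[symmetric]
    using D by (simp add: field_simps) (simp add: D_def power2_eq_square algebra_simps)
  also have "\<dots> > 1"
    using P a D by (simp add: abs_square_less_1)
  finally show ?thesis
    using extremal_in_class_B[OF a] by blast
qed

theorem theorem3:
  fixes m :: nat
  assumes "m \<ge> 1"
  shows
    "(\<exists>\<gamma>::real.
        {r \<in> {0<..<1}. r ^ m * (r ^ m + 2) * (2 * r ^ 2 - r + 1) + 2 * r ^ 2 + r - 1 = 0} = {\<gamma>}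
      \<and> (\<forall>f\<in>class_B. \<forall>\<omega>\<in>class_Bm m. \<forall>z. norm z \<le> \<gamma> \<longrightarrow> bohr_E f \<omega> z \<le> 1)
      \<and> \<not> (\<exists>\<rho>\<in>{\<gamma><..<1}. \<forall>f\<in>class_B. \<forall>\<omega>\<in>class_Bm m. \<forall>z. norm z \<le> \<rho> \<longrightarrow> bohr_E f \<omega> z \<le> 1))
   \<and> (\<exists>\<delta>::real.
        {r \<in> {0<..<1}. (r ^ (2 * m) + r ^ m - 1) * (1 - r) + r ^ 2 * (1 + r ^ m) ^ 2 = 0} = {\<delta>}
      \<and> (\<forall>f\<in>class_B. \<forall>\<omega>\<in>class_Bm m. \<forall>z. norm z \<le> \<delta> \<longrightarrow> bohr_F f \<omega> z \<le> 1)
      \<and> \<not> (\<exists>\<rho>\<in>{\<delta><..<1}. \<forall>f\<in>class_B. \<forall>\<omega>\<in>class_Bm m. \<forall>z. norm z \<le> \<rho> \<longrightarrow> bohr_F f \<omega> z \<le> 1))"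
proof (rule conjI)
  let ?G = "\<lambda>r::real. r ^ m * (r ^ m + 2) * (2 * r ^ 2 - r + 1) + 2 * r ^ 2 + r - 1"
  let ?h = "\<lambda>r::real. (1 + r ^ m) ^ 2 * (1 + 2 * (r ^ 2 / (1 - r))) - 2"
  have Gh: "?G r = (1 - r) * ?h r" if "0 \<le> r" "r < 1" for r
  proof -
    have "(1 - r) * (r ^ 2 / (1 - r)) = r ^ 2"
      using that by simp
    moreover have "(1 - r) * (A * (1 + 2 * q) - 2) = A * ((1 - r) + 2 * ((1 - r) * q)) - 2 * (1 - r)"
      for A q :: real
      by (simp add: algebra_simps)
    ultimately have "(1 - r) * ?h r = (1 + r ^ m) ^ 2 * ((1 - r) + 2 * r ^ 2) - 2 * (1 - r)"
      by (simp only:)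
    then show ?thesis
      by (simp add: power2_eq_square algebra_simps)
  qed
  have cont: "continuous_on {0..1} ?G"
    by (intro continuous_intros)
  obtain \<gamma> where root: "{r \<in> {0<..<1}. ?G r = 0} = {\<gamma>}" and \<gamma>: "0 < \<gamma>" "\<gamma> < 1"
    and below: "\<And>r. 0 \<le> r \<Longrightarrow> r \<le> \<gamma> \<Longrightarrow> ?h r \<le> 0"
    and above: "\<And>r. \<gamma> < r \<Longrightarrow> r < 1 \<Longrightarrow> ?h r > 0"
    by (rule unique_sign_change[OF cont _ _ Gh strict_mono_gamma[OF assms]])
       (use assms in \<open>auto simp: power_0_left\<close>)
  have "bohr_E f \<omega> z \<le> 1" if "f \<in> class_B" "\<omega> \<in> class_Bm m" "norm z \<le> \<gamma>" for f \<omega> z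
    using that assms \<gamma> below[of "norm z"] by (intro bohr_E_le_1[where r = "norm z"]) auto
  moreover have "\<exists>f\<in>class_B. \<exists>\<omega>\<in>class_Bm m. \<exists>z. norm z \<le> \<rho> \<and> bohr_E f \<omega> z > 1"
    if \<rho>: "\<rho> \<in> {\<gamma><..<1}" for \<rho>
  proof -
    have "0 < \<rho>" "\<rho> < 1" "?h \<rho> > 0"
      using \<rho> \<gamma> above[of \<rho>] by auto
    then obtain f where "f \<in> class_B" "bohr_E f (\<lambda>z. z ^ m) (of_real \<rho>) > 1"
      using bohr_E_sharp[OF assms] by blast
    moreover have "norm (of_real \<rho> :: complex) \<le> \<rho>"
      using \<open>0 < \<rho>\<close> by simp
    ultimately show ?thesis
      using power_in_class_Bm[OF assms] by blast
  qed
  ultimately show "\<exists>\<gamma>::real. {r \<in> {0<..<1}. ?G r = 0} = {\<gamma>}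
      \<and> (\<forall>f\<in>class_B. \<forall>\<omega>\<in>class_Bm m. \<forall>z. norm z \<le> \<gamma> \<longrightarrow> bohr_E f \<omega> z \<le> 1)
      \<and> \<not> (\<exists>\<rho>\<in>{\<gamma><..<1}. \<forall>f\<in>class_B. \<forall>\<omega>\<in>class_Bm m. \<forall>z. norm z \<le> \<rho> \<longrightarrow> bohr_E f \<omega> z \<le> 1)"
    using root by (intro exI[of _ \<gamma>]) (meson not_le)
next
  let ?H = "\<lambda>r::real. (r ^ (2 * m) + r ^ m - 1) * (1 - r) + r ^ 2 * (1 + r ^ m) ^ 2"
  let ?h = "\<lambda>r::real. (r ^ m) ^ 2 + r ^ m - 1 + r ^ 2 / (1 - r) * (1 + r ^ m) ^ 2"
  have Hh: "?H r = (1 - r) * ?h r" if "0 \<le> r" "r < 1" for r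
  proof -
    have "(1 - r) * (r ^ 2 / (1 - r) * (1 + r ^ m) ^ 2) = r ^ 2 * (1 + r ^ m) ^ 2"
      using that by simp
    moreover have "r ^ (2 * m) = (r ^ m) ^ 2"
      by (simp add: mult.commute flip: power_mult)
    ultimately show ?thesis
      by (simp only: distrib_left mult.commute[of "1 - r" "(r ^ m) ^ 2 + r ^ m - 1"])
  qed
  have cont: "continuous_on {0..1} ?H"
    by (intro continuous_intros)
  obtain \<delta> where root: "{r \<in> {0<..<1}. ?H r = 0} = {\<delta>}" and \<delta>: "0 < \<delta>" "\<delta> < 1"
    and below: "\<And>r. 0 \<le> r \<Longrightarrow> r \<le> \<delta> \<Longrightarrow> ?h r \<le> 0"
    and above: "\<And>r. \<delta> < r \<Longrightarrow> r < 1 \<Longrightarrow> ?h r > 0"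
    by (rule unique_sign_change[OF cont _ _ Hh strict_mono_delta[OF assms]])
       (use assms in \<open>auto simp: power_0_left\<close>)
  have "bohr_F f \<omega> z \<le> 1" if "f \<in> class_B" "\<omega> \<in> class_Bm m" "norm z \<le> \<delta>" for f \<omega> z
    using that assms \<delta> below[of "norm z"] by (intro bohr_F_le_1[where r = "norm z"]) auto
  moreover have "\<exists>f\<in>class_B. \<exists>\<omega>\<in>class_Bm m. \<exists>z. norm z \<le> \<rho> \<and> bohr_F f \<omega> z > 1"
    if \<rho>: "\<rho> \<in> {\<delta><..<1}" for \<rho>
  proof -
    have "0 < \<rho>" "\<rho> < 1" "?h \<rho> > 0"
      using \<rho> \<delta> above[of \<rho>] by auto
    then obtain f where "f \<in> class_B" "bohr_F f (\<lambda>z. z ^ m) (of_real \<rho>) > 1"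
      using bohr_F_sharp[OF assms] by blast
    moreover have "norm (of_real \<rho> :: complex) \<le> \<rho>"
      using \<open>0 < \<rho>\<close> by simp
    ultimately show ?thesis
      using power_in_class_Bm[OF assms] by blast
  qed
  ultimately show "\<exists>\<delta>::real. {r \<in> {0<..<1}. ?H r = 0} = {\<delta>}
      \<and> (\<forall>f\<in>class_B. \<forall>\<omega>\<in>class_Bm m. \<forall>z. norm z \<le> \<delta> \<longrightarrow> bohr_F f \<omega> z \<le> 1)
      \<and> \<not> (\<exists>\<rho>\<in>{\<delta><..<1}. \<forall>f\<in>class_B. \<forall>\<omega>\<in>class_Bm m. \<forall>z. norm z \<le> \<rho> \<longrightarrow> bohr_F f \<omega> z \<le> 1)"
    using root by (intro exI[of _ \<delta>]) (meson not_le)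
qed

end
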